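(* Let $n\ge 3$ and let $M$ be a catenoid in $\mathbb{R}^{n+1}$, with second fundamental form $A$. Then $M$ is $\frac2n$-stable, i.e. $$\int_M\left(|\nabla f|^2-\left(1-\tfrac2n\right)|A|^2f^2\right)\ge 0\qquad\text{for all } f\in C_0^\infty(M).$$
   Context: Catenoid: let $n\ge 3$ and $\phi_0>0$. Let $\phi$ be the solution of $$\frac{\phi''}{(1+\phi'^2)^{3/2}}-\frac{n-1}{\phi(1+\phi'^2)^{1/2}}=0,\qquad \phi(0)=\phi_0,\qquad \phi'(0)=0 .$$ It is an even smooth positive function defined on the maximal interval $I=(-S,S)$, where $S=S(\phi_0)=\int_{\phi_0}^{\infty}\frac{d\tau}{(a\tau^{2(n-1)}-1)^{1/2}}<\infty$ and $a=\phi_0^{-2(n-1)}$. A catenoid in $\mathbb{R}^{n+1}$ is the image of the embedding $F:I\times\mathbb{S}^{n-1}\to\mathbb{R}^{n+1}$, $F(s,\omega)=(\phi(s)\omega,s)$, where $\mathbb{S}^{n-1}\subset\mathbb{R}^n$ is the unit sphere, or any hypersurface obtained from such an image by a rigid motion of $\mathbb{R}^{n+1}$. *)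

theory Defs
  imports "HOL-Analysis.Analysis"
begin

subsection \<open>Smooth maps\<close>

text \<open>Meaningful for open \<open>S\<close>: all iterated directional derivatives up to order \<open>k\<close>
  exist and are continuous.\<close>

primrec Ck_on :: "nat \<Rightarrow> ('a::euclidean_space \<Rightarrow> 'b::euclidean_space) \<Rightarrow> 'a set \<Rightarrow> bool" where
  "Ck_on 0 f S \<longleftrightarrow> continuous_on S f"
| "Ck_on (Suc k) f S \<longleftrightarrow> (\<forall>x\<in>S. f differentiable (at x)) \<and>
     (\<forall>v. Ck_on k (\<lambda>x. frechet_derivative f (at x) v) S)"

definition smooth_on :: "('a::euclidean_space \<Rightarrow> 'b::euclidean_space) \<Rightarrow> 'a set \<Rightarrow> bool" where
  "smooth_on f S \<longleftrightarrow> (\<forall>k. Ck_on k f S)"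

subsection \<open>Hypersurfaces of Euclidean space\<close>

text \<open>\<open>\<real>\<^sup>n\<^sup>+\<^sup>1\<close> is \<open>\<real>\<^sup>n \<times> \<real>\<close> with its (Euclidean) product inner product, \<open>n = CARD('n)\<close>.
  The following notions are meant for an embedded smooth hypersurface \<open>M\<close>. Functions on \<open>M\<close>
  are total functions whose values off \<open>M\<close> are irrelevant.\<close>

type_synonym 'n ambient = "(real ^ 'n) \<times> real"

definition curve_in :: "('n::finite) ambient set \<Rightarrow> 'n ambient \<Rightarrow> (real \<Rightarrow> 'n ambient) \<Rightarrow> 'n ambient \<Rightarrow> bool"
  where "curve_in M p \<gamma> v \<longleftrightarrow>
    \<gamma> 0 = p \<and> (\<forall>\<^sub>F t in nhds 0. \<gamma> t \<in> M) \<and> (\<gamma> has_vector_derivative v) (at 0)"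

definition tangent_space :: "('n::finite) ambient set \<Rightarrow> 'n ambient \<Rightarrow> 'n ambient set" where
  "tangent_space M p = {v. \<exists>\<gamma>. curve_in M p \<gamma> v}"

text \<open>\<open>\<langle>\<nabla>f(p), w\<rangle> = df(p)(w)\<close> for all tangent vectors \<open>w\<close>.\<close>

definition surface_gradient :: "('n::finite) ambient set \<Rightarrow> ('n ambient \<Rightarrow> real) \<Rightarrow> 'n ambient \<Rightarrow> 'n ambient"
  where "surface_gradient M f p = (THE v. v \<in> tangent_space M p \<and>
    (\<forall>\<gamma> w. curve_in M p \<gamma> w \<longrightarrow> ((\<lambda>t. f (\<gamma> t)) has_real_derivative (v \<bullet> w)) (at 0)))"

definition local_unit_normal :: "('n::finite) ambient set \<Rightarrow> 'n ambient \<Rightarrow> ('n ambient \<Rightarrow> 'n ambient) \<Rightarrow> bool"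
  where "local_unit_normal M p N \<longleftrightarrow> (\<exists>W. open W \<and> p \<in> W \<and> Ck_on 1 N W \<and>
    (\<forall>q\<in>M \<inter> W. norm (N q) = 1 \<and> (\<forall>v\<in>tangent_space M q. N q \<bullet> v = 0)))"

text \<open>\<open>A(v,w) = - \<langle>D\<^sub>v N, w\<rangle>\<close>. On tangent vectors it depends on the choice of the local unit
  normal \<open>N\<close> only through its sign, which does not affect \<open>|A|\<^sup>2\<close>.\<close>

definition second_fundamental_form ::
  "('n::finite) ambient set \<Rightarrow> 'n ambient \<Rightarrow> 'n ambient \<Rightarrow> 'n ambient \<Rightarrow> real" where
  "second_fundamental_form M p v w =
     - (frechet_derivative (SOME N. local_unit_normal M p N) (at p) v \<bullet> w)"

definition orthonormal_basis_of :: "('a::euclidean_space) set \<Rightarrow> 'a set \<Rightarrow> bool" where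
  "orthonormal_basis_of T B \<longleftrightarrow>
     B \<subseteq> T \<and> pairwise orthogonal B \<and> (\<forall>b\<in>B. norm b = 1) \<and> span B = T"

text \<open>\<open>|A|\<^sup>2\<close>; the value does not depend on the chosen orthonormal basis of the tangent space.\<close>

definition norm_sq_second_fundamental_form :: "('n::finite) ambient set \<Rightarrow> 'n ambient \<Rightarrow> real" where
  "norm_sq_second_fundamental_form M p =
     (let B = (SOME B. orthonormal_basis_of (tangent_space M p) B)
      in \<Sum>v\<in>B. \<Sum>w\<in>B. (second_fundamental_form M p v w)\<^sup>2)"

text \<open>\<open>C\<^sup>1\<close> regularity of unit normals and parametrizations is enough: the second fundamental
  form and the volume measure of a smooth hypersurface come out the same as with \<open>C\<^sup>\<infinity>\<close>.\<close>

definition local_parametrization ::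
  "('n::finite) ambient set \<Rightarrow> (real ^ 'n) set \<Rightarrow> (real ^ 'n \<Rightarrow> 'n ambient) \<Rightarrow> bool" where
  "local_parametrization M U X \<longleftrightarrow>
     open U \<and> Ck_on 1 X U \<and> (\<forall>x\<in>U. inj (frechet_derivative X (at x))) \<and>
     openin (top_of_set M) (X ` U) \<and> (\<exists>Y. homeomorphism U (X ` U) X Y)"

definition gram_matrix :: "(real ^ 'n \<Rightarrow> ('n::finite) ambient) \<Rightarrow> real ^ 'n \<Rightarrow> real ^ 'n ^ 'n" where
  "gram_matrix X x = (\<chi> i j. frechet_derivative X (at x) (axis i 1) \<bullet>
                              frechet_derivative X (at x) (axis j 1))"

text \<open>The Riemannian volume measure of the induced metric: the Borel measure on \<open>M\<close> given by
  \<open>\<surd>det(g\<^sub>i\<^sub>j) dx\<close> in every local parametrization.\<close>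

definition surface_measure :: "('n::finite) ambient set \<Rightarrow> 'n ambient measure" where
  "surface_measure M = (THE \<mu>. space \<mu> = M \<and> sets \<mu> = sets (restrict_space borel M) \<and>
     (\<forall>U X. local_parametrization M U X \<longrightarrow>
        (\<forall>E\<in>sets borel. E \<subseteq> U \<longrightarrow>
           emeasure \<mu> (X ` E) = (\<integral>\<^sup>+x\<in>E. ennreal (sqrt (det (gram_matrix X x))) \<partial>lborel))))"

definition smooth_function_on :: "('n::finite) ambient set \<Rightarrow> ('n ambient \<Rightarrow> real) \<Rightarrow> bool" where
  "smooth_function_on M f \<longleftrightarrow>
     (\<forall>p\<in>M. \<exists>W g. open W \<and> p \<in> W \<and> smooth_on g W \<and> (\<forall>q\<in>M \<inter> W. f q = g q))"

definition test_function_on :: "('n::finite) ambient set \<Rightarrow> ('n ambient \<Rightarrow> real) \<Rightarrow> bool" where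
  "test_function_on M f \<longleftrightarrow>
     smooth_function_on M f \<and> compact (M \<inter> closure {p \<in> M. f p \<noteq> 0})"

definition delta_stable :: "real \<Rightarrow> ('n::finite) ambient set \<Rightarrow> bool" where
  "delta_stable \<delta> M \<longleftrightarrow> (\<forall>f. test_function_on M f \<longrightarrow>
     (\<integral>p. ((norm (surface_gradient M f p))\<^sup>2
            - (1 - \<delta>) * norm_sq_second_fundamental_form M p * (f p)\<^sup>2) \<partial>surface_measure M) \<ge> 0)"

subsection \<open>Catenoids\<close>

definition catenoid_halfwidth :: "nat \<Rightarrow> real \<Rightarrow> real" where
  "catenoid_halfwidth n \<phi>\<^sub>0 = (let a = 1 / \<phi>\<^sub>0 ^ (2 * (n - 1))
     in LBINT \<tau>:{\<phi>\<^sub>0<..}. 1 / sqrt (a * \<tau> ^ (2 * (n - 1)) - 1))"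

definition catenoid_interval :: "nat \<Rightarrow> real \<Rightarrow> real set" where
  "catenoid_interval n \<phi>\<^sub>0 = {- catenoid_halfwidth n \<phi>\<^sub>0 <..< catenoid_halfwidth n \<phi>\<^sub>0}"

definition catenoid_profile :: "nat \<Rightarrow> real \<Rightarrow> (real \<Rightarrow> real) \<Rightarrow> bool" where
  "catenoid_profile n \<phi>\<^sub>0 \<phi> \<longleftrightarrow>
     \<phi> 0 = \<phi>\<^sub>0 \<and> deriv \<phi> 0 = 0 \<and>
     (\<forall>s\<in>catenoid_interval n \<phi>\<^sub>0.
        \<phi> s > 0 \<and> \<phi> differentiable (at s) \<and> deriv \<phi> differentiable (at s) \<and>
        deriv (deriv \<phi>) s / (1 + (deriv \<phi> s)\<^sup>2) powr (3/2)
          - (real n - 1) / (\<phi> s * (1 + (deriv \<phi> s)\<^sup>2) powr (1/2)) = 0)"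

text \<open>Orientation-reversing isometries yield no further catenoids, since the image of
  \<open>(s,\<omega>) \<mapsto> (\<phi>(s)\<omega>, s)\<close> is symmetric under \<open>s \<mapsto> -s\<close>.\<close>

definition rigid_motion :: "('a::euclidean_space \<Rightarrow> 'a) \<Rightarrow> bool" where
  "rigid_motion g \<longleftrightarrow> (\<exists>T a. orthogonal_transformation T \<and> g = (\<lambda>x. T x + a))"

definition is_catenoid :: "('n::finite) ambient set \<Rightarrow> bool" where
  "is_catenoid M \<longleftrightarrow> (\<exists>\<phi>\<^sub>0 \<phi> g. \<phi>\<^sub>0 > 0 \<and> catenoid_profile CARD('n) \<phi>\<^sub>0 \<phi> \<and> rigid_motion g \<and>
     M = g ` ((\<lambda>(s, \<omega>). (\<phi> s *\<^sub>R \<omega>, s)) ` (catenoid_interval CARD('n) \<phi>\<^sub>0 \<times> sphere 0 1)))"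

end

(* Write W = sqrt (1 + phi'^2). At (phi(s) w, s) the catenoid has the principal curvature 1 / (phi W)
   with multiplicity n - 1 and - (n - 1) / (phi W) once, so |A|^2 = n (n - 1) / (phi W)^2. The volume
   element is W phi^(n-1) ds dw, and phi^(n-1) / W is a first integral of the profile equation.
   Dropping the spherical part of the gradient, the stability form is bounded below, on each meridian
   w = const, by a constant times the integral of h'^2 - (n - 1) (n - 2) h^2 / phi^2 ds with
   h(s) = f(phi(s) w, s). With q = (2 - n) phi' / phi this integrand is (h' - q h)^2 + (q h^2)',
   and h has compact support. *)

theory Submission imports Defs begin

section \<open>Change of variables for nonnegative functions\<close>

text \<open>The surface measure, the gradient and the unit normal are given by descriptions
  (\<open>THE\<close>, \<open>SOME\<close>). Much of the proof shows that these descriptions are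
  met, above all that one pushforward measure has the prescribed value in every local
  parametrization; the change of variables formula serves this purpose. Coordinates are chosen so
  that meridians become lines parallel to \<open>axis k 1\<close>, while stereographic coordinates
  of the sphere fill the other entries. The spherical volume factor is then constant along each line
  and is never evaluated. The function q is the logarithmic derivative of phi^(2-n), a positive
  solution of u'' + (n-1)(n-2) u / phi^2 = 0 on the whole interval; such a solution makes the
  one-dimensional form nonnegative. The constant 2/n is the one for which (1 - 2/n) n (n-1) =
  (n-1)(n-2). The integral of a nonintegrable function is 0 by convention, so integrability of the
  stability integrand is settled by a case distinction.\<close>

lemma absolutely_integrable_iff_nn_integral:
  fixes f :: "'a::euclidean_space \<Rightarrow> real"
  assumes meas: "(\<lambda>x. indicator S x * f x) \<in> borel_measurable borel"
    and nonneg: "\<And>x. x \<in> S \<Longrightarrow> 0 \<le> f x"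
  shows "f absolutely_integrable_on S \<and> integral S f = b \<longleftrightarrow>
    0 \<le> b \<and> (\<integral>\<^sup>+x. ennreal (indicator S x * f x) \<partial>lborel) = ennreal b"
proof -
  have "f absolutely_integrable_on S \<and> integral S f = b \<longleftrightarrow> (f has_integral b) S"
    using nonnegative_absolutely_integrable_1[of f S] nonneg
    by (auto simp: absolutely_integrable_on_def has_integral_iff)
  also have "\<dots> \<longleftrightarrow> ((\<lambda>x. indicator S x * f x) has_integral b) UNIV"
    by (subst has_integral_restrict_UNIV[symmetric])
      (intro has_integral_cong, simp add: indicator_def)
  also have "\<dots> \<longleftrightarrow> 0 \<le> b \<and> (\<integral>\<^sup>+x. ennreal (indicator S x * f x) \<partial>lborel) = ennreal b"
  proof (intro iffI conjI; (elim conjE)?)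
    assume *: "((\<lambda>x. indicator S x * f x) has_integral b) UNIV"
    show "0 \<le> b" using has_integral_nonneg[OF *] nonneg by (auto simp: indicator_def)
    show "(\<integral>\<^sup>+x. ennreal (indicator S x * f x) \<partial>lborel) = ennreal b"
      using nn_integral_has_integral_lborel[OF meas _ *] nonneg by (auto simp: indicator_def)
  next
    assume "0 \<le> b" "(\<integral>\<^sup>+x. ennreal (indicator S x * f x) \<partial>lborel) = ennreal b"
    then show "((\<lambda>x. indicator S x * f x) has_integral b) UNIV"
      using meas nonneg by (intro nn_integral_has_integral) (auto simp: indicator_def)
  qed
  finally show ?thesis .
qed

text \<open>The library formula is an equivalence: one side is integrable with value b iff the other
  is. By \<open>absolutely_integrable_iff_nn_integral\<close> the two extended integrals therefore
  take the same finite values, and so they are infinite together as well.\<close>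

lemma nn_integral_change_of_variables_wellorder:
  fixes T :: "real^'m::{finite,wellorder} \<Rightarrow> real^'m::_" and h :: "real^'m::_ \<Rightarrow> real"
  assumes E: "E \<in> sets borel"
    and der: "\<And>x. x \<in> E \<Longrightarrow> (T has_derivative T' x) (at x within E)"
    and inj: "inj_on T E"
    and nonneg: "\<And>x. x \<in> E \<Longrightarrow> 0 \<le> h (T x)"
    and m1: "(\<lambda>y. indicator (T ` E) y * h y) \<in> borel_measurable borel"
    and m2: "(\<lambda>x. indicator E x * (\<bar>det (matrix (T' x))\<bar> * h (T x))) \<in> borel_measurable borel"
  shows "(\<integral>\<^sup>+y. ennreal (indicator (T ` E) y * h y) \<partial>lborel) =
    (\<integral>\<^sup>+x. ennreal (indicator E x * (\<bar>det (matrix (T' x))\<bar> * h (T x))) \<partial>lborel)" (is "?L = ?R")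
proof -
  \<comment> \<open>The formula is stated for vector-valued integrands; \<open>vec\<close> puts the
    scalar function into \<open>real ^ 1\<close>.\<close>
  have "(\<lambda>x. \<bar>det (matrix (T' x))\<bar> *\<^sub>R (vec (h (T x)) :: real ^ 1)) absolutely_integrable_on E \<and>
           integral E (\<lambda>x. \<bar>det (matrix (T' x))\<bar> *\<^sub>R vec (h (T x))) = (vec b :: real ^ 1)
         \<longleftrightarrow> (\<lambda>x. vec (h x) :: real ^ 1) absolutely_integrable_on (T ` E) \<and>
           integral (T ` E) (\<lambda>x. vec (h x)) = (vec b :: real ^ 1)" for b
    using E by (intro has_absolute_integral_change_of_variables der inj) auto
  then have "(\<lambda>x. \<bar>det (matrix (T' x))\<bar> * h (T x)) absolutely_integrable_on E \<and>
           integral E (\<lambda>x. \<bar>det (matrix (T' x))\<bar> * h (T x)) = b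
         \<longleftrightarrow> h absolutely_integrable_on (T ` E) \<and> integral (T ` E) h = b" for b
    by (simp add: absolutely_integrable_on_1_iff integral_on_1_eq)
  then have *: "(0 \<le> b \<and> ?R = ennreal b) = (0 \<le> b \<and> ?L = ennreal b)" for b
    using absolutely_integrable_iff_nn_integral[OF m1, of b]
      absolutely_integrable_iff_nn_integral[OF m2, of b] nonneg by auto
  show ?thesis
  proof (cases ?L)
    case (real r)
    then show ?thesis using *[of r] by auto
  next
    case top
    then show ?thesis
    proof (cases ?R)
      case (real r)
      then show ?thesis using *[of r] by auto
    qed auto
  qed
qed

text \<open>The library states the change of variables formula for well-ordered index types only.
  An arbitrary finite index type is equipotent to the following well-ordered copy of it.\<close>

typedef ('n::finite) ordered_index = "UNIV :: 'n set" ..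

instantiation ordered_index :: (finite) wellorder
begin

definition less_eq_ordered_index :: "'a ordered_index \<Rightarrow> 'a ordered_index \<Rightarrow> bool" where
  "x \<le> y \<longleftrightarrow> to_nat (Rep_ordered_index x) \<le> to_nat (Rep_ordered_index y)"

definition less_ordered_index :: "'a ordered_index \<Rightarrow> 'a ordered_index \<Rightarrow> bool" where
  "x < y \<longleftrightarrow> to_nat (Rep_ordered_index x) < to_nat (Rep_ordered_index y)"

instance
proof
  fix P :: "'a ordered_index \<Rightarrow> bool" and a :: "'a ordered_index"
  assume step: "\<And>x. (\<And>y. y < x \<Longrightarrow> P y) \<Longrightarrow> P x"
  show "P a" 
    by (induction a rule: measure_induct_rule[where f="\<lambda>x. to_nat (Rep_ordered_index x)"])
      (rule step, simp add: less_ordered_index_def)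
qed (auto simp: less_eq_ordered_index_def less_ordered_index_def Rep_ordered_index_inject)

end

instance ordered_index :: (finite) finite
proof
  have "(UNIV :: 'a ordered_index set) = range Abs_ordered_index"
    by (auto intro: Rep_ordered_index_inverse[symmetric])
  then show "finite (UNIV :: 'a ordered_index set)"
    by (metis finite finite_imageI)
qed

lemma bij_Rep_ordered_index: "bij Rep_ordered_index"
  by (rule bij_betwI[where g=Abs_ordered_index])
    (auto simp: Rep_ordered_index_inverse Abs_ordered_index_inverse)

text \<open>Conjugation by \<open>f\<close> turns the transposition of a and b into that of
  \<open>inv f a\<close> and \<open>inv f b\<close>, so a word of transpositions keeps its
  length.\<close>

lemma swapidseq_conj:
  fixes f :: "'m \<Rightarrow> 'n"
  assumes f: "bij f"
  shows "swapidseq n p \<Longrightarrow> swapidseq n (inv f \<circ> p \<circ> f)"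
proof (induction rule: swapidseq.induct)
  case id
  then show ?case using f by (simp add: fun_eq_iff bij_is_inj)
next
  case (comp_Suc n p a b)
  have "inv f \<circ> (Transposition.transpose a b \<circ> p) \<circ> f = Transposition.transpose (inv f a) (inv f b) \<circ> (inv f \<circ> p \<circ> f)"
  proof
    fix x
    have *: "(inv f y = inv f z) = (y = z)" for y z
      using f by (metis bij_inv_eq_iff)
    show "(inv f \<circ> (Transposition.transpose a b \<circ> p) \<circ> f) x = (Transposition.transpose (inv f a) (inv f b) \<circ> (inv f \<circ> p \<circ> f)) x"
      by (simp add: Transposition.transpose_def *)
  qed
  moreover have "inv f a \<noteq> inv f b"
    using f comp_Suc(2) by (metis bij_inv_eq_iff)
  ultimately show ?case
    using swapidseq.comp_Suc[OF comp_Suc(3)] by metis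
qed

lemma sign_conj:
  fixes f :: "'m::finite \<Rightarrow> 'n::finite"
  assumes f: "bij f" and p: "p permutes UNIV"
  shows "sign (inv f \<circ> p \<circ> f) = sign p"
proof -
  obtain n where n: "swapidseq n p"
    using p permutation_permutes[of p] by (auto simp: permutation_def)
  then have "evenperm p = even n" "evenperm (inv f \<circ> p \<circ> f) = even n"
    using swapidseq_conj[OF f n] by (auto intro!: evenperm_unique)
  then show ?thesis by (simp add: sign_def)
qed

text \<open>Conjugation by \<open>f\<close> is a sign-preserving bijection between the permutations
  of the two index types, and it matches the terms of the two Leibniz sums.\<close>

lemma det_reindex:
  fixes A :: "'a::comm_ring_1 ^ 'n ^ 'n" and f :: "'m::finite \<Rightarrow> 'n::finite"
  assumes f: "bij f"
  shows "det (\<chi> i j. A $ f i $ f j) = det A"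
proof -
  have "det (\<chi> i j. A $ f i $ f j) =
    (\<Sum>p | p permutes UNIV. of_int (sign p) * (\<Prod>i\<in>UNIV. A $ f i $ f (p i)))"
    by (simp add: det_def)
  also have "\<dots> = (\<Sum>p | p permutes UNIV. of_int (sign p) * (\<Prod>i\<in>UNIV. A $ i $ p i))"
  proof (rule sum.reindex_bij_witness[where i="\<lambda>p. inv f \<circ> p \<circ> f" and j="\<lambda>p. f \<circ> p \<circ> inv f"])
    fix p :: "'n \<Rightarrow> 'n" assume p: "p \<in> {p. p permutes UNIV}"
    show "f \<circ> (inv f \<circ> p \<circ> f) \<circ> inv f = p"
      using f by (auto simp: fun_eq_iff bij_is_surj surj_f_inv_f)
    have "bij (inv f \<circ> p \<circ> f)"
      using f p by (intro bij_comp bij_imp_bij_inv) (auto simp: permutes_bij)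
    then show "inv f \<circ> p \<circ> f \<in> {p. p permutes UNIV}"
      by (auto intro!: bij_imp_permutes)
  next
    fix p :: "'m \<Rightarrow> 'm" assume p: "p \<in> {p. p permutes UNIV}"
    show "inv f \<circ> (f \<circ> p \<circ> inv f) \<circ> f = p"
      using f by (auto simp: fun_eq_iff bij_is_inj inv_f_f)
    have "bij (f \<circ> p \<circ> inv f)"
      using f p by (intro bij_comp bij_imp_bij_inv) (auto simp: permutes_bij)
    then show "f \<circ> p \<circ> inv f \<in> {p. p permutes UNIV}"
      by (auto intro!: bij_imp_permutes)
    have "sign (f \<circ> p \<circ> inv f) = sign p"
      using sign_conj[of "inv f" p] f p by (simp add: bij_imp_bij_inv inv_inv_eq)
    moreover have "(\<Prod>i\<in>UNIV. A $ i $ (f \<circ> p \<circ> inv f) i) = (\<Prod>i\<in>UNIV. A $ f i $ f (p i))"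
      using f by (subst prod.reindex_bij_betw[OF f, symmetric]) (auto simp: bij_is_inj inv_f_f)
    ultimately show "of_int (sign (f \<circ> p \<circ> inv f)) * (\<Prod>i\<in>UNIV. A $ i $ (f \<circ> p \<circ> inv f) i) =
       of_int (sign p) * (\<Prod>i\<in>UNIV. A $ f i $ f (p i))" by simp
  qed
  finally show ?thesis by (simp add: det_def)
qed

text \<open>Relabelling coordinates pulls a box back to a box with the same side lengths in another
  order, and the volumes of boxes characterize \<open>lborel\<close>.\<close>

lemma lborel_distr_reindex:
  fixes f :: "'m::finite \<Rightarrow> 'n::finite"
  assumes f: "bij f"
  shows "distr lborel borel (\<lambda>x :: real^'n. \<chi> i. x $ f i) = (lborel :: (real^'m) measure)"
proof (rule lborel_eqI[symmetric])
  have m: "(\<lambda>x :: real^'n. \<chi> i. x $ f i) \<in> borel_measurable borel"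
    by (intro borel_measurable_continuous_onI continuous_intros)
  fix l u :: "real^'m" assume lu: "\<And>b. b \<in> Basis \<Longrightarrow> l \<bullet> b \<le> u \<bullet> b"
  have lu': "l $ i \<le> u $ i" for i
    using lu[of "axis i 1"] by (simp add: inner_axis axis_in_Basis_iff)
  have pr: "(\<Prod>b\<in>Basis. v \<bullet> b) = (\<Prod>i\<in>UNIV. v $ i)" for v :: "real^'k"
  proof -
    have B: "Basis = range (\<lambda>i. axis i 1 :: real^'k)" by (auto simp: Basis_vec_def)
    show ?thesis unfolding B
      by (subst prod.reindex) (auto simp: inj_on_def axis_eq_axis inner_axis)
  qed
  define l' u' :: "real^'n" where "l' = (\<chi> i. l $ inv f i)" and "u' = (\<chi> i. u $ inv f i)"
  have "(\<lambda>x :: real^'n. \<chi> i. x $ f i) -` box l u = box l' u'"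
  proof (intro set_eqI iffI)
    fix x :: "real^'n" assume "x \<in> (\<lambda>x :: real^'n. \<chi> i. x $ f i) -` box l u"
    then have "l $ i < x $ f i \<and> x $ f i < u $ i" for i
      by (simp add: mem_box_cart)
    from this[of "inv f j" for j] show "x \<in> box l' u'"
      using f by (simp add: mem_box_cart l'_def u'_def bij_is_surj surj_f_inv_f)
  next
    fix x :: "real^'n" assume "x \<in> box l' u'"
    then have "l $ inv f i < x $ i \<and> x $ i < u $ inv f i" for i
      by (simp add: mem_box_cart l'_def u'_def)
    from this[of "f j" for j] show "x \<in> (\<lambda>x :: real^'n. \<chi> i. x $ f i) -` box l u"
      using f by (simp add: mem_box_cart bij_is_inj inv_f_f)
  qed
  then have "emeasure (distr lborel borel (\<lambda>x :: real^'n. \<chi> i. x $ f i)) (box l u) =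
    emeasure lborel (box l' u')"
    using m by (simp add: emeasure_distr)
  also have "\<dots> = ennreal (\<Prod>b\<in>Basis. (u' - l') \<bullet> b)"
  proof (rule emeasure_lborel_box)
    fix b :: "real^'n" assume "b \<in> Basis"
    then obtain i where "b = axis i 1" by (auto simp: Basis_vec_def)
    then show "l' \<bullet> b \<le> u' \<bullet> b" using lu' by (simp add: l'_def u'_def inner_axis)
  qed
  also have "(\<Prod>b\<in>Basis. (u' - l') \<bullet> b) = (\<Prod>b\<in>Basis. (u - l) \<bullet> b)"
    unfolding pr
    by (subst prod.reindex_bij_betw[OF bij_imp_bij_inv[OF f], symmetric])
      (simp add: l'_def u'_def)
  finally show "emeasure (distr lborel borel (\<lambda>x :: real^'n. \<chi> i. x $ f i)) (box l u) =
    ennreal (\<Prod>b\<in>Basis. (u - l) \<bullet> b)" .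
qed simp

text \<open>The well-ordered case is applied to \<open>T\<close> conjugated by the relabellings
  \<open>r\<close> and \<open>s\<close>, which change neither Lebesgue measure nor the Jacobian
  determinant.\<close>

theorem nn_integral_change_of_variables:
  fixes T :: "real^'n::finite \<Rightarrow> real^'n" and h :: "real^'n \<Rightarrow> real"
  assumes E: "E \<in> sets borel"
    and der: "\<And>x. x \<in> E \<Longrightarrow> (T has_derivative T' x) (at x within E)"
    and inj: "inj_on T E"
    and nonneg: "\<And>x. x \<in> E \<Longrightarrow> 0 \<le> h (T x)"
    and m1: "(\<lambda>y. indicator (T ` E) y * h y) \<in> borel_measurable borel"
    and m2: "(\<lambda>x. indicator E x * (\<bar>det (matrix (T' x))\<bar> * h (T x))) \<in> borel_measurable borel"
  shows "(\<integral>\<^sup>+y. ennreal (indicator (T ` E) y * h y) \<partial>lborel) =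
    (\<integral>\<^sup>+x. ennreal (indicator E x * (\<bar>det (matrix (T' x))\<bar> * h (T x))) \<partial>lborel)"
proof -
  define r :: "real^'n \<Rightarrow> real^('n ordered_index)" where "r = (\<lambda>x. \<chi> i. x $ Rep_ordered_index i)"
  define s :: "real^('n ordered_index) \<Rightarrow> real^'n" where "s = (\<lambda>x. \<chi> i. x $ Abs_ordered_index i)"
  note AR = Rep_ordered_index_inverse Abs_ordered_index_inverse
  have rs [simp]: "r (s x) = x" "s (r y) = y" for x y
    by (simp_all add: r_def s_def vec_eq_iff AR)
  have bl: "bounded_linear r" "bounded_linear s"
    unfolding r_def s_def by (auto intro!: linearI simp: vec_eq_iff simp flip: linear_conv_bounded_linear)
  then have r_lin: "linear r" and s_lin: "linear s" by (auto simp: linear_conv_bounded_linear)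
  have [measurable]: "r \<in> borel_measurable borel" "s \<in> borel_measurable borel"
    using bl by (auto intro!: borel_measurable_continuous_onI linear_continuous_on)
  have s_distr: "distr lborel borel s = lborel"
    unfolding s_def
    by (rule lborel_distr_reindex, rule bij_betwI[where g=Rep_ordered_index]) (auto simp: AR)
  define E2 T2 h2 T2' where "E2 = s -` E" and "T2 = (\<lambda>x. r (T (s x)))" and "h2 = (\<lambda>x. h (s x))"
    and "T2' = (\<lambda>x v. r (T' (s x) (s v)))"
  have E2: "E2 \<in> sets borel"
    using measurable_sets[OF \<open>s \<in> borel_measurable borel\<close> E] by (simp add: E2_def)
  have im: "T2 ` E2 = s -` (T ` E)"
  proof (intro set_eqI iffI)
    fix y assume "y \<in> s -` (T ` E)"
    then obtain x where "x \<in> E" "s y = T x" by auto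
    then have "y = T2 (r x)" "r x \<in> E2" by (auto simp: T2_def E2_def) (metis rs(1))
    then show "y \<in> T2 ` E2" by auto
  qed (auto simp: E2_def T2_def)
  have sE2: "s ` E2 = E"
    unfolding E2_def by (metis rs(2) surj_def surj_image_vimage_eq)
  have der2: "(T2 has_derivative T2' x) (at x within E2)" if "x \<in> E2" for x
  proof -
    have 1: "(s has_derivative s) (at x within E2)"
      using bl by (simp add: bounded_linear_imp_has_derivative)
    have 2: "(T has_derivative T' (s x)) (at (s x) within s ` E2)"
      unfolding sE2 using that by (intro der) (simp add: E2_def)
    have "((\<lambda>x. r (T (s x))) has_derivative (\<lambda>v. r (T' (s x) (s v)))) (at x within E2)"
      using bounded_linear.has_derivative[OF bl(1) diff_chain_within[OF 1 2]] by (simp add: o_def)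
    then show ?thesis by (simp add: T2_def T2'_def)
  qed
  have det2: "det (matrix (T2' x)) = det (matrix (T' (s x)))" for x
  proof -
    have "matrix (T2' x) = (\<chi> i j. matrix (T' (s x)) $ Rep_ordered_index i $ Rep_ordered_index j)"
    proof -
      have "Abs_ordered_index i = j \<longleftrightarrow> i = Rep_ordered_index j" for i :: 'n and j
        by (metis AR UNIV_I)
      then have sx: "s (axis j 1) = axis (Rep_ordered_index j) 1" for j
        by (simp only: s_def vec_eq_iff axis_def vec_lambda_beta simp_thms)
      show ?thesis by (simp add: matrix_def T2'_def sx) (simp add: vec_eq_iff r_def)
    qed
    then show ?thesis using det_reindex[OF bij_Rep_ordered_index] by metis
  qed
  have i1: "indicator (T2 ` E2) y * h2 y = indicator (T ` E) (s y) * h (s y)" for y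
    by (simp add: im h2_def indicator_def)
  have i2: "indicator E2 x * (\<bar>det (matrix (T2' x))\<bar> * h2 (T2 x)) =
     indicator E (s x) * (\<bar>det (matrix (T' (s x)))\<bar> * h (T (s x)))" for x
    by (simp add: E2_def T2_def h2_def indicator_def det2)
  have "(\<integral>\<^sup>+y. ennreal (indicator (T2 ` E2) y * h2 y) \<partial>lborel) =
    (\<integral>\<^sup>+x. ennreal (indicator E2 x * (\<bar>det (matrix (T2' x))\<bar> * h2 (T2 x))) \<partial>lborel)"
  proof (rule nn_integral_change_of_variables_wellorder[OF E2 der2])
    show "inj_on T2 E2"
    proof (rule inj_onI)
      fix x y assume "x \<in> E2" "y \<in> E2" "T2 x = T2 y"
      then have "s x = s y"
        using inj_onD[OF inj, of "s x" "s y"] by (metis E2_def T2_def rs(2) vimage_eq)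
      then show "x = y" by (metis rs(1))
    qed
    show "0 \<le> h2 (T2 x)" if "x \<in> E2" for x
      using nonneg that by (simp add: h2_def T2_def E2_def)
    show "(\<lambda>y. indicator (T2 ` E2) y * h2 y) \<in> borel_measurable borel"
      unfolding i1 using measurable_compose[OF \<open>s \<in> borel_measurable borel\<close> m1] by simp
    show "(\<lambda>x. indicator E2 x * (\<bar>det (matrix (T2' x))\<bar> * h2 (T2 x))) \<in> borel_measurable borel"
      unfolding i2 using measurable_compose[OF \<open>s \<in> borel_measurable borel\<close> m2] by simp
  qed
  then have "(\<integral>\<^sup>+y. ennreal (indicator (T ` E) y * h y) \<partial>distr lborel borel s) =
    (\<integral>\<^sup>+x. ennreal (indicator E x * (\<bar>det (matrix (T' x))\<bar> * h (T x))) \<partial>distr lborel borel s)"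
    unfolding i1 i2 using m1 m2 by (simp add: nn_integral_distr)
  then show ?thesis unfolding s_distr .
qed

section \<open>Charts and the surface measure\<close>

lemma Ck_on_1_D:
  assumes "Ck_on 1 X U"
  shows "\<And>x. x \<in> U \<Longrightarrow> X differentiable (at x)"
    and "\<And>x. x \<in> U \<Longrightarrow> (X has_derivative frechet_derivative X (at x)) (at x)"
    and "\<And>v. continuous_on U (\<lambda>x. frechet_derivative X (at x) v)"
    and "continuous_on U X"
proof -
  show d: "X differentiable (at x)" if "x \<in> U" for x
    using assms that by simp
  then show "(X has_derivative frechet_derivative X (at x)) (at x)" if "x \<in> U" for x
    using that by (simp add: frechet_derivative_works)
  show "continuous_on U (\<lambda>x. frechet_derivative X (at x) v)" for v
    using assms by simp
  show "continuous_on U X"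
    using d by (meson continuous_at_imp_continuous_on differentiable_imp_continuous_within)
qed

lemma Ck_on_1_I:
  assumes "open U"
    and "\<And>x. x \<in> U \<Longrightarrow> (X has_derivative X' x) (at x)"
    and "\<And>v. continuous_on U (\<lambda>x. X' x v)"
  shows "Ck_on 1 X U"
proof -
  have "frechet_derivative X (at x) = X' x" if "x \<in> U" for x
    using assms(2)[OF that] by (rule frechet_derivative_at[symmetric])
  then have "continuous_on U (\<lambda>x. frechet_derivative X (at x) v)" for v
    using assms(3)[of v] by (simp cong: continuous_on_cong)
  then show ?thesis
    using assms(2) by (auto simp: differentiable_def)
qed

text \<open>\<open>sqrt\<close> is odd, so the maximum discards a (never occurring) negative determinant,
  just as \<^const>\<open>ennreal\<close> does.\<close>

definition volume_density :: "(real ^ 'n \<Rightarrow> ('n::finite) ambient) \<Rightarrow> real ^ 'n \<Rightarrow> real" where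
  "volume_density X x = max 0 (sqrt (det (gram_matrix X x)))"

lemma volume_density_nonneg: "0 \<le> volume_density X x"
  by (simp add: volume_density_def)

lemma ennreal_volume_density: "ennreal (volume_density X x) = ennreal (sqrt (det (gram_matrix X x)))"
  by (simp add: volume_density_def max_def ennreal_neg)

lemma continuous_on_volume_density:
  assumes "Ck_on 1 X U"
  shows "continuous_on U (volume_density X)"
  unfolding volume_density_def det_def gram_matrix_def
  by (simp, intro continuous_intros Ck_on_1_D(3)[OF assms])

lemma borel_measurable_indicator_volume_density:
  assumes "Ck_on 1 X U" "E \<in> sets borel" "E \<subseteq> U"
  shows "(\<lambda>x. indicator E x * volume_density X x) \<in> borel_measurable borel"
  using borel_measurable_continuous_on_indicator[OF assms(2)
      continuous_on_subset[OF continuous_on_volume_density[OF assms(1)] assms(3)]] by simp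

text \<open>A Gram matrix represents a pulled-back inner product, so precomposition with
  \<open>B\<close> acts on it by congruence. The two resulting factors det B become |det B| under
  the square root of the volume density.\<close>

lemma gram_comp:
  fixes A :: "real^'n::finite \<Rightarrow> 'a::real_inner" and B :: "real^'n \<Rightarrow> real^'n"
  assumes A: "linear A"
  shows "(\<chi> i j. A (B (axis i 1)) \<bullet> A (B (axis j 1))) =
    transpose (matrix B) ** (\<chi> i j. A (axis i 1) \<bullet> A (axis j 1)) ** matrix B"
proof -
  have *: "A v = (\<Sum>k\<in>UNIV. v $ k *\<^sub>R A (axis k 1))" for v
  proof -
    have "A v = A (\<Sum>k\<in>UNIV. v $ k *\<^sub>R axis k 1)"
      by (simp add: basis_expansion[of v, unfolded scalar_mult_eq_scaleR])
    then show ?thesis using A by (simp add: linear_sum linear_cmul)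
  qed
  show ?thesis
    by (simp add: vec_eq_iff matrix_matrix_mult_def transpose_def matrix_def *[of "B _"]
        inner_sum_left inner_sum_right sum_distrib_left sum_distrib_right mult_ac)
qed

text \<open>The inverse \<open>Y\<close> is differentiable on an open set of the ambient space, not
  merely continuous on \<open>M\<close>. Hence \<open>Y\<close> after any other parametrization is
  differentiable by the chain rule, without an inverse function theorem.\<close>

definition adapted_chart ::
  "('n::finite) ambient set \<Rightarrow> (real ^ 'n) set \<Rightarrow> (real ^ 'n \<Rightarrow> 'n ambient) \<Rightarrow>
    ('n ambient \<Rightarrow> real ^ 'n) \<Rightarrow> 'n ambient set \<Rightarrow> bool" where
  "adapted_chart M U X Y V \<longleftrightarrow> open U \<and> open V \<and> Ck_on 1 X U \<and>
     (\<forall>p\<in>V. Y differentiable (at p)) \<and> X ` U = M \<inter> V \<and> (\<forall>x\<in>U. Y (X x) = x)"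

lemma adapted_chartD:
  assumes "adapted_chart M U X Y V"
  shows "open U" "open V" "Ck_on 1 X U" "\<And>p. p \<in> V \<Longrightarrow> Y differentiable (at p)"
    "X ` U = M \<inter> V" "\<And>x. x \<in> U \<Longrightarrow> Y (X x) = x"
    "\<And>x. x \<in> U \<Longrightarrow> X x \<in> M" "\<And>x. x \<in> U \<Longrightarrow> X x \<in> V"
    "\<And>p. p \<in> M \<Longrightarrow> p \<in> V \<Longrightarrow> Y p \<in> U" "\<And>p. p \<in> M \<Longrightarrow> p \<in> V \<Longrightarrow> X (Y p) = p"
proof -
  note * = assms[unfolded adapted_chart_def]
  show "open U" "open V" "Ck_on 1 X U" "\<And>p. p \<in> V \<Longrightarrow> Y differentiable (at p)"
    "X ` U = M \<inter> V" "\<And>x. x \<in> U \<Longrightarrow> Y (X x) = x"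
    using * by blast+
  show "\<And>x. x \<in> U \<Longrightarrow> X x \<in> M" "\<And>x. x \<in> U \<Longrightarrow> X x \<in> V"
    using * by blast+
  have "\<exists>x\<in>U. p = X x" if "p \<in> M" "p \<in> V" for p
    using * that by blast
  then show "\<And>p. p \<in> M \<Longrightarrow> p \<in> V \<Longrightarrow> Y p \<in> U" "\<And>p. p \<in> M \<Longrightarrow> p \<in> V \<Longrightarrow> X (Y p) = p"
    using * by fastforce+
qed

lemma adapted_chart_derivative:
  assumes "adapted_chart M U X Y V" "x \<in> U"
  shows "(Y has_derivative frechet_derivative Y (at (X x))) (at (X x))"
    and "frechet_derivative Y (at (X x)) (frechet_derivative X (at x) v) = v"
proof -
  note D = adapted_chartD[OF assms(1)]
  show Y: "(Y has_derivative frechet_derivative Y (at (X x))) (at (X x))"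
    using D(4)[OF D(8)[OF assms(2)]] by (simp add: frechet_derivative_works)
  have "((\<lambda>x. Y (X x)) has_derivative
      (\<lambda>v. frechet_derivative Y (at (X x)) (frechet_derivative X (at x) v))) (at x)"
    using diff_chain_at[OF Ck_on_1_D(2)[OF D(3) assms(2)] Y] by (simp add: o_def)
  moreover have "((\<lambda>x. Y (X x)) has_derivative (\<lambda>v. v)) (at x)"
    by (rule has_derivative_transform_within_open[OF has_derivative_ident D(1) assms(2)])
      (simp add: D(6))
  ultimately show "frechet_derivative Y (at (X x)) (frechet_derivative X (at x) v) = v"
    using has_derivative_unique by metis
qed

lemma adapted_chart_imp_local_parametrization:
  assumes "adapted_chart M U X Y V"
  shows "local_parametrization M U X"
proof -
  note D = adapted_chartD[OF assms]
  have "continuous_on (X ` U) Y"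
    using D(4,5) by (intro continuous_at_imp_continuous_on ballI differentiable_imp_continuous_within) auto
  then have "homeomorphism U (X ` U) X Y"
    using Ck_on_1_D(4)[OF D(3)] D(6) by (auto simp: homeomorphism_def image_image)
  moreover have "inj (frechet_derivative X (at x))" if "x \<in> U" for x
    using adapted_chart_derivative(2)[OF assms that] by (metis injI)
  ultimately show ?thesis
    unfolding local_parametrization_def using D(1,2,3,5) by (auto simp: openin_open)
qed

text \<open>Near x the map \<open>X\<close> factors as \<open>X1\<close> after the transition map,
  because \<open>X1\<close> undoes \<open>Y1\<close> on \<open>M\<close> inside \<open>V1\<close>.
  The chain rule and \<open>gram_comp\<close> then compare the two Gram determinants.\<close>

lemma volume_density_transition:
  assumes X: "open U" "Ck_on 1 X U" "X ` U \<subseteq> M" and C: "adapted_chart M U1 X1 Y1 V1"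
    and x: "x \<in> U" "X x \<in> V1"
  defines "T' \<equiv> \<lambda>v. frechet_derivative Y1 (at (X x)) (frechet_derivative X (at x) v)"
  shows "((\<lambda>x. Y1 (X x)) has_derivative T') (at x)"
    and "volume_density X x = \<bar>det (matrix T')\<bar> * volume_density X1 (Y1 (X x))"
proof -
  note D = adapted_chartD[OF C]
  have xM: "X x \<in> M" using X(3) x by auto
  have eq: "X1 (Y1 (X x)) = X x" using D(10) xM x by blast
  show T: "((\<lambda>x. Y1 (X x)) has_derivative T') (at x)"
    using diff_chain_at[OF Ck_on_1_D(2)[OF X(2) x(1)] D(4)[OF x(2), unfolded frechet_derivative_works]]
    by (simp add: o_def T'_def)
  have X1: "(X1 has_derivative frechet_derivative X1 (at (Y1 (X x)))) (at (Y1 (X x)))"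
    using D(9)[OF xM x(2)] by (rule Ck_on_1_D(2)[OF D(3)])
  have "open (U \<inter> X -` V1)"
    using continuous_open_preimage[OF Ck_on_1_D(4)[OF X(2)] X(1) D(2)] .
  moreover have "X1 (Y1 (X y)) = X y" if "y \<in> U \<inter> X -` V1" for y
    using that D(10) X(3) by blast
  ultimately have "(X has_derivative (\<lambda>v. frechet_derivative X1 (at (Y1 (X x))) (T' v))) (at x)"
    using has_derivative_transform_within_open[OF diff_chain_at[OF T X1], of "U \<inter> X -` V1" X] x
    by (simp add: o_def)
  then have "frechet_derivative X (at x) = (\<lambda>v. frechet_derivative X1 (at (Y1 (X x))) (T' v))"
    by (metis frechet_derivative_at)
  then have "gram_matrix X x =
      transpose (matrix T') ** gram_matrix X1 (Y1 (X x)) ** matrix T'"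
    unfolding gram_matrix_def
    using gram_comp[of "frechet_derivative X1 (at (Y1 (X x)))" T'] has_derivative_linear[OF X1] by simp
  then have "sqrt (det (gram_matrix X x)) =
      \<bar>det (matrix T')\<bar> * sqrt (det (gram_matrix X1 (Y1 (X x))))"
    by (simp add: det_mul det_transpose real_sqrt_mult)
  then show "volume_density X x = \<bar>det (matrix T')\<bar> * volume_density X1 (Y1 (X x))"
    by (simp add: volume_density_def max_mult_distrib_left)
qed

lemma sets_chart_preimage:
  assumes "adapted_chart M U X Y V" "A \<in> sets (restrict_space borel M)"
  shows "{x \<in> U. X x \<in> A} \<in> sets borel"
proof -
  note D = adapted_chartD[OF assms(1)]
  obtain B where B: "B \<in> sets borel" "A = M \<inter> B"
    using assms(2) by (auto simp: sets_restrict_space)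
  have "X \<in> borel_measurable (restrict_space borel U)"
    by (rule borel_measurable_continuous_on_restrict[OF Ck_on_1_D(4)[OF D(3)]])
  from measurable_sets[OF this B(1)]
  have "X -` B \<inter> U \<in> sets (restrict_space borel U)" by (simp add: space_restrict_space)
  then have "X -` B \<inter> U \<in> sets borel"
    using D(1) by (subst (asm) sets_restrict_space_iff) auto
  also have "X -` B \<inter> U = {x \<in> U. X x \<in> A}" using D(7) B by auto
  finally show ?thesis .
qed

text \<open>The image of \<open>E\<close> is its preimage under the continuous inverse of
  \<open>X\<close>, and the image of \<open>U\<close> is relatively open in
  \<open>M\<close>.\<close>

lemma sets_parametrization_image:
  assumes "local_parametrization M U X" "E \<in> sets borel" "E \<subseteq> U"
  shows "X ` E \<in> sets (restrict_space borel M)"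
proof -
  obtain Y where Y: "homeomorphism U (X ` U) X Y" and op: "openin (top_of_set M) (X ` U)"
    using assms(1) by (auto simp: local_parametrization_def)
  obtain O' where O': "open O'" "X ` U = M \<inter> O'" using op by (auto simp: openin_open)
  have "Y \<in> borel_measurable (restrict_space borel (X ` U))"
    using Y by (intro borel_measurable_continuous_on_restrict) (simp add: homeomorphism_def)
  from measurable_sets[OF this assms(2)]
  have "Y -` E \<inter> X ` U \<in> sets (restrict_space borel (X ` U))" by (simp add: space_restrict_space)
  then obtain B where B: "B \<in> sets borel" "Y -` E \<inter> X ` U = X ` U \<inter> B"
    by (auto simp: sets_restrict_space)
  have "X ` E = Y -` E \<inter> X ` U"
    using Y assms(3) by (auto simp: homeomorphism_def image_iff)
  also have "\<dots> = M \<inter> (O' \<inter> B)" using B O' by auto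
  finally show ?thesis using B O' by (auto simp: sets_restrict_space)
qed

text \<open>Chart independence of the volume on the part of \<open>M\<close> seen by
  \<open>X1\<close>. The substitution is the transition map, \<open>Y1\<close> after
  \<open>X\<close>, which is injective on \<open>E\<close> because \<open>X\<close> is.\<close>

lemma nn_integral_volume_density_transition:
  assumes X: "local_parametrization M U X" and C: "adapted_chart M U1 X1 Y1 V1"
    and E: "E \<in> sets borel" "E \<subseteq> U" "X ` E \<subseteq> V1"
  shows "(\<integral>\<^sup>+x\<in>E. ennreal (volume_density X x) \<partial>lborel) =
    (\<integral>\<^sup>+x\<in>{x \<in> U1. X1 x \<in> X ` E}. ennreal (volume_density X1 x) \<partial>lborel)"
proof -
  note D = adapted_chartD[OF C]
  have U: "open U" "Ck_on 1 X U" and XM: "X ` U \<subseteq> M"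
    using X by (auto simp: local_parametrization_def openin_open simp del: Ck_on.simps)
  have inj: "inj_on X U"
    using X unfolding local_parametrization_def homeomorphism_def inj_on_def by metis
  define T where "T = (\<lambda>x. Y1 (X x))"
  define T' where "T' = (\<lambda>x v. frechet_derivative Y1 (at (X x)) (frechet_derivative X (at x) v))"
  have TE: "T ` E = {x \<in> U1. X1 x \<in> X ` E}"
  proof (intro set_eqI iffI)
    fix y assume "y \<in> T ` E"
    then obtain x where x: "x \<in> E" "y = Y1 (X x)" by (auto simp: T_def)
    then have "X x \<in> M" "X x \<in> V1" using E XM by auto
    then show "y \<in> {x \<in> U1. X1 x \<in> X ` E}" using D(9,10) x by auto
  next
    fix y assume "y \<in> {x \<in> U1. X1 x \<in> X ` E}"
    then obtain x where "x \<in> E" "y \<in> U1" "X1 y = X x" by auto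
    then show "y \<in> T ` E" using D(6)[of y] by (auto simp: T_def)
  qed
  have TEb: "T ` E \<in> sets borel"
    unfolding TE by (rule sets_chart_preimage[OF C sets_parametrization_image[OF X E(1,2)]])
  have trans: "(T has_derivative T' x) (at x)"
    "volume_density X x = \<bar>det (matrix (T' x))\<bar> * volume_density X1 (T x)" if "x \<in> E" for x
    using volume_density_transition[OF U XM C, of x] that E by (auto simp: T_def T'_def)
  have eq: "indicator E x * (\<bar>det (matrix (T' x))\<bar> * volume_density X1 (T x)) =
      indicator E x * volume_density X x" for x
    using trans(2)[of x] by (simp add: indicator_def)
  have "(\<integral>\<^sup>+y. ennreal (indicator (T ` E) y * volume_density X1 y) \<partial>lborel) =
    (\<integral>\<^sup>+x. ennreal (indicator E x * (\<bar>det (matrix (T' x))\<bar> * volume_density X1 (T x))) \<partial>lborel)"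
  proof (rule nn_integral_change_of_variables[OF E(1)])
    show "(T has_derivative T' x) (at x within E)" if "x \<in> E" for x
      using trans(1)[OF that] by (rule has_derivative_at_withinI)
    show "inj_on T E"
    proof (rule inj_onI)
      fix x y assume xy: "x \<in> E" "y \<in> E" "T x = T y"
      then have "X1 (Y1 (X x)) = X1 (Y1 (X y))" by (simp add: T_def)
      moreover have "X x \<in> M" "X x \<in> V1" "X y \<in> M" "X y \<in> V1" using xy E XM by auto
      ultimately have "X x = X y" using D(10) by metis
      then show "x = y" using inj xy E by (metis inj_on_def subsetD)
    qed
    show "(\<lambda>y. indicator (T ` E) y * volume_density X1 y) \<in> borel_measurable borel"
      by (rule borel_measurable_indicator_volume_density[OF D(3) TEb]) (auto simp: TE)
    show "(\<lambda>x. indicator E x * (\<bar>det (matrix (T' x))\<bar> * volume_density X1 (T x)))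
        \<in> borel_measurable borel"
      unfolding eq by (rule borel_measurable_indicator_volume_density[OF U(2) E(1,2)])
  qed (simp add: volume_density_nonneg)
  then have "(\<integral>\<^sup>+x. ennreal (indicator E x * volume_density X x) \<partial>lborel) =
      (\<integral>\<^sup>+y. ennreal (indicator (T ` E) y * volume_density X1 y) \<partial>lborel)"
    unfolding eq by simp
  moreover have "ennreal (indicator S x * volume_density Z x) = ennreal (volume_density Z x) * indicator S x"
    for S and Z :: "real^'a \<Rightarrow> 'a ambient" and x by (simp add: indicator_def)
  ultimately show ?thesis unfolding TE by simp
qed

section \<open>The surface measure as a pushforward under one chart\<close>

definition chart_measure ::
  "('n::finite) ambient set \<Rightarrow> (real ^ 'n) set \<Rightarrow> (real ^ 'n \<Rightarrow> 'n ambient) \<Rightarrow> 'n ambient measure" where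
  "chart_measure M U X = distr (density (restrict_space lborel U) (\<lambda>x. ennreal (volume_density X x)))
     (restrict_space borel M) X"

lemma chart_measurable:
  assumes "adapted_chart M U X Y V"
  shows "X \<in> measurable (restrict_space lborel U) (restrict_space borel M)"
    and "(\<lambda>x. volume_density X x) \<in> borel_measurable (restrict_space lborel U)"
proof -
  note D = adapted_chartD[OF assms]
  have s: "sets (restrict_space lborel U :: (real^'a) measure) = sets (restrict_space borel U)"
    by (rule sets_restrict_space_cong) simp
  show "X \<in> measurable (restrict_space lborel U) (restrict_space borel M)"
    unfolding measurable_cong_sets[OF s refl]
    using D(7) borel_measurable_continuous_on_restrict[OF Ck_on_1_D(4)[OF D(3)]]
    by (intro measurable_restrict_space2) (auto simp: space_restrict_space)
  show "(\<lambda>x. volume_density X x) \<in> borel_measurable (restrict_space lborel U)"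
    unfolding measurable_cong_sets[OF s refl]
    by (rule borel_measurable_continuous_on_restrict[OF continuous_on_volume_density[OF D(3)]])
qed

lemma emeasure_chart_measure:
  assumes C: "adapted_chart M U X Y V" and A: "A \<in> sets (restrict_space borel M)"
  shows "emeasure (chart_measure M U X) A =
    (\<integral>\<^sup>+x\<in>{x \<in> U. X x \<in> A}. ennreal (volume_density X x) \<partial>lborel)"
proof -
  note D = adapted_chartD[OF C]
  note m = chart_measurable[OF C]
  have U: "U \<inter> space lborel \<in> sets lborel" using D(1) by simp
  have pre: "X -` A \<inter> U = {x \<in> U. X x \<in> A}" by auto
  have b: "{x \<in> U. X x \<in> A} \<in> sets borel" by (rule sets_chart_preimage[OF C A])
  have "{x \<in> U. X x \<in> A} \<in> sets (restrict_space lborel U)"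
    using b D(1) by (subst sets_restrict_space_iff) auto
  then have "emeasure (chart_measure M U X) A =
    (\<integral>\<^sup>+x\<in>{x \<in> U. X x \<in> A}. ennreal (volume_density X x) \<partial>restrict_space lborel U)"
    unfolding chart_measure_def using m A
    by (subst emeasure_distr) (auto simp: emeasure_density space_restrict_space pre)
  also have "\<dots> = (\<integral>\<^sup>+x\<in>{x \<in> U. X x \<in> A}. ennreal (volume_density X x) \<partial>lborel)"
    by (subst nn_integral_restrict_space[OF U]) (auto intro!: nn_integral_cong simp: indicator_def)
  finally show ?thesis .
qed

text \<open>A second chart is needed only to see that the part of \<open>M\<close> missed by the first one is null.\<close>

theorem surface_measure_eq_chart_measure:
  assumes C1: "adapted_chart M U1 X1 Y1 V1" and C2: "adapted_chart M U2 X2 Y2 V2"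
    and cover: "M \<subseteq> V1 \<union> V2"
    and null: "{x \<in> U2. X2 x \<notin> V1} \<in> null_sets lborel"
  shows "surface_measure M = chart_measure M U1 X1"
proof -
  note D1 = adapted_chartD[OF C1] and D2 = adapted_chartD[OF C2]
  let ?N = "{x \<in> U2. X2 x \<notin> V1}"
  have null0: "(\<integral>\<^sup>+x\<in>S. f x \<partial>lborel) = 0" if "S \<subseteq> ?N" for S and f :: "real^'a \<Rightarrow> ennreal"
  proof -
    have "AE x in lborel. f x * indicator S x = 0"
      using AE_not_in[OF null] that by (auto simp: indicator_def elim: eventually_mono)
    then have "(\<integral>\<^sup>+x\<in>S. f x \<partial>lborel) = (\<integral>\<^sup>+x. 0 \<partial>(lborel :: (real^'a) measure))"
      by (rule nn_integral_cong_AE)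
    then show ?thesis by simp
  qed
  have sets_M: "M \<inter> V1 \<in> sets (restrict_space borel M)"
    using D1(2) by (auto simp: sets_restrict_space)
  have measure_image: "emeasure (chart_measure M U1 X1) (X ` E) =
      (\<integral>\<^sup>+x\<in>E. ennreal (sqrt (det (gram_matrix X x))) \<partial>lborel)"
    if X: "local_parametrization M U X" and E: "E \<in> sets borel" "E \<subseteq> U" for U X E
  proof -
    have U: "open U" "Ck_on 1 X U" and XM: "X ` U \<subseteq> M"
      using X by (auto simp: local_parametrization_def openin_open simp del: Ck_on.simps)
    \<comment> \<open>\<open>E1\<close> is the part of \<open>E\<close> that \<open>X\<close> sends
      into the first chart; the image of the rest \<open>E - E1\<close> is covered by the second
      chart.\<close>
    define E1 where "E1 = {x \<in> E. X x \<in> V1}"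
    have "open (U \<inter> X -` V1)"
      using continuous_open_preimage[OF Ck_on_1_D(4)[OF U(2)] U(1) D1(2)] .
    moreover have "E1 = E \<inter> (U \<inter> X -` V1)" using E by (auto simp: E1_def)
    ultimately have E1: "E1 \<in> sets borel" "E - E1 \<in> sets borel" "E1 \<subseteq> U" "E - E1 \<subseteq> U"
      using E by auto
    have XE1: "X ` E1 \<subseteq> V1" by (auto simp: E1_def)
    have XE2: "X ` (E - E1) \<subseteq> V2" using cover XM E by (fastforce simp: E1_def)
    have set_eq: "{x \<in> U1. X1 x \<in> X ` E} = {x \<in> U1. X1 x \<in> X ` E1}"
    proof (intro set_eqI iffI)
      fix x assume "x \<in> {x \<in> U1. X1 x \<in> X ` E}"
      then obtain y where "x \<in> U1" "y \<in> E" "X1 x = X y" by auto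
      moreover have "X y \<in> V1" using calculation D1(8)[of x] by simp
      ultimately show "x \<in> {x \<in> U1. X1 x \<in> X ` E1}" by (auto simp: E1_def)
    qed (auto simp: E1_def)
    have "emeasure (chart_measure M U1 X1) (X ` E) =
      (\<integral>\<^sup>+x\<in>{x \<in> U1. X1 x \<in> X ` E1}. ennreal (volume_density X1 x) \<partial>lborel)"
      using emeasure_chart_measure[OF C1 sets_parametrization_image[OF X E]] unfolding set_eq .
    also have "\<dots> = (\<integral>\<^sup>+x\<in>E1. ennreal (volume_density X x) \<partial>lborel)"
      by (rule nn_integral_volume_density_transition[OF X C1 E1(1,3) XE1, symmetric])
    \<comment> \<open>The added term is 0: moved to the second chart, its domain lies in the null
      set \<open>?N\<close>.\<close>
    also have "\<dots> = (\<integral>\<^sup>+x\<in>E1. ennreal (volume_density X x) \<partial>lborel) +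
        (\<integral>\<^sup>+x\<in>E - E1. ennreal (volume_density X x) \<partial>lborel)"
    proof -
      have "{x \<in> U2. X2 x \<in> X ` (E - E1)} \<subseteq> ?N" by (auto simp: E1_def)
      then show ?thesis
        using nn_integral_volume_density_transition[OF X C2 E1(2,4) XE2] null0 by simp
    qed
    also have "\<dots> = (\<integral>\<^sup>+x. ennreal (indicator E1 x * volume_density X x) +
        ennreal (indicator (E - E1) x * volume_density X x) \<partial>lborel)"
    proof -
      have m: "(\<lambda>x. ennreal (indicator E1 x * volume_density X x)) \<in> borel_measurable lborel"
        "(\<lambda>x. ennreal (indicator (E - E1) x * volume_density X x)) \<in> borel_measurable lborel"
        using borel_measurable_indicator_volume_density[OF U(2) E1(1,3)]
          borel_measurable_indicator_volume_density[OF U(2) E1(2,4)]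
        by (simp_all add: measurable_lborel2 measurable_compose[OF _ measurable_ennreal])
      show ?thesis
        unfolding nn_integral_add[OF m]
        by (intro arg_cong2[where f="(+)"] nn_integral_cong) (simp_all add: indicator_def)
    qed
    also have "\<dots> = (\<integral>\<^sup>+x\<in>E. ennreal (sqrt (det (gram_matrix X x))) \<partial>lborel)"
      by (rule nn_integral_cong) (auto simp: indicator_def E1_def ennreal_volume_density)
    finally show ?thesis .
  qed
  show ?thesis
    unfolding surface_measure_def
  proof (rule the_equality, intro conjI allI impI ballI)
    show "space (chart_measure M U1 X1) = M" "sets (chart_measure M U1 X1) = sets (restrict_space borel M)"
      by (simp_all add: chart_measure_def space_restrict_space)
  next
    fix \<mu> :: "'a ambient measure"
    assume *: "space \<mu> = M \<and> sets \<mu> = sets (restrict_space borel M) \<and>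
     (\<forall>U X. local_parametrization M U X \<longrightarrow>
        (\<forall>E\<in>sets borel. E \<subseteq> U \<longrightarrow>
           emeasure \<mu> (X ` E) = (\<integral>\<^sup>+x\<in>E. ennreal (sqrt (det (gram_matrix X x))) \<partial>lborel)))"
    then have prop\<mu>: "emeasure \<mu> (X ` E) = (\<integral>\<^sup>+x\<in>E. ennreal (volume_density X x) \<partial>lborel)"
      if "adapted_chart M U X Y V" "E \<in> sets borel" "E \<subseteq> U" for U X Y V E
      using adapted_chart_imp_local_parametrization[OF that(1)] that(2,3)
      by (simp add: ennreal_volume_density)
    show "\<mu> = chart_measure M U1 X1"
    proof (rule measure_eqI)
      show "sets \<mu> = sets (chart_measure M U1 X1)" using * by (simp add: chart_measure_def)
      fix A assume "A \<in> sets \<mu>"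
      then have A: "A \<in> sets (restrict_space borel M)" and AM: "A \<subseteq> M"
        using * sets.sets_into_space[of A \<mu>] by auto
      have A': "A \<inter> (M \<inter> V1) \<in> sets (restrict_space borel M)" "A - M \<inter> V1 \<in> sets (restrict_space borel M)"
        using A sets_M by blast+
      \<comment> \<open>Uniqueness: \<open>A\<close> splits into the image of \<open>?E1\<close>
        under the first chart and the image of \<open>?E2\<close>, a subset of \<open>?N\<close>,
        under the second, so the prescribed values determine the measure of
        \<open>A\<close>.\<close>
      let ?E1 = "{x \<in> U1. X1 x \<in> A}" and ?E2 = "{x \<in> U2. X2 x \<in> A - M \<inter> V1}"
      have E1: "X1 ` ?E1 = A \<inter> (M \<inter> V1)" unfolding D1(5)[symmetric] by blast
      have "X2 ` ?E2 = (A - M \<inter> V1) \<inter> X2 ` U2" by blast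
      then have E2: "X2 ` ?E2 = A - M \<inter> V1" unfolding D2(5) using AM cover by blast
      have "emeasure \<mu> A = emeasure \<mu> (A \<inter> (M \<inter> V1)) + emeasure \<mu> (A - M \<inter> V1)"
        using A' * by (subst plus_emeasure) (auto intro: arg_cong[where f="emeasure \<mu>"])
      also have "emeasure \<mu> (A - M \<inter> V1) = 0"
      proof -
        have "emeasure \<mu> (X2 ` ?E2) = 0"
          by (subst prop\<mu>[OF C2 sets_chart_preimage[OF C2 A'(2)]], blast, rule null0)
            (use D2(7) in auto)
        then show ?thesis unfolding E2 .
      qed
      also have "emeasure \<mu> (A \<inter> (M \<inter> V1)) = emeasure (chart_measure M U1 X1) A"
        unfolding E1[symmetric] emeasure_chart_measure[OF C1 A]
        by (rule prop\<mu>[OF C1 sets_chart_preimage[OF C1 A]]) auto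
      finally show "emeasure \<mu> A = emeasure (chart_measure M U1 X1) A" by simp
    qed
  qed (use measure_image in auto)
qed

lemma integral_chart_measure:
  fixes F :: "('n::finite) ambient \<Rightarrow> real"
  assumes C: "adapted_chart M U X Y V" and F: "integrable (chart_measure M U X) F"
  shows "integrable lborel (\<lambda>x. indicator U x * (volume_density X x * F (X x)))"
    and "(\<integral>p. F p \<partial>chart_measure M U X) =
      (\<integral>x. indicator U x * (volume_density X x * F (X x)) \<partial>lborel)"
proof -
  note D = adapted_chartD[OF C] and m = chart_measurable[OF C]
  have U: "U \<inter> space lborel \<in> sets lborel" using D(1) by simp
  let ?d = "density (restrict_space lborel U) (\<lambda>x. ennreal (volume_density X x))"
  have Fm: "F \<in> borel_measurable (restrict_space borel M)"
    using borel_measurable_integrable[OF F] by (simp add: chart_measure_def)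
  have Xm: "X \<in> measurable ?d (restrict_space borel M)" using m by simp
  have FXm: "(\<lambda>x. F (X x)) \<in> borel_measurable (restrict_space lborel U)"
    using measurable_compose[OF m(1) Fm] .
  have "integrable ?d (\<lambda>x. F (X x))"
    using F unfolding chart_measure_def by (rule integrable_distr[OF Xm])
  then have "integrable (restrict_space lborel U) (\<lambda>x. volume_density X x * F (X x))"
    using integrable_density[OF FXm m(2)] by (simp add: volume_density_nonneg)
  then show "integrable lborel (\<lambda>x. indicator U x * (volume_density X x * F (X x)))"
    by (subst (asm) integrable_restrict_space[OF U]) simp
  have "(\<integral>p. F p \<partial>chart_measure M U X) = (\<integral>x. F (X x) \<partial>?d)"
    unfolding chart_measure_def by (rule integral_distr[OF Xm Fm])
  also have "\<dots> = (\<integral>x. volume_density X x * F (X x) \<partial>restrict_space lborel U)"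
    using integral_density[OF FXm m(2)] by (simp add: volume_density_nonneg)
  also have "\<dots> = (\<integral>x. indicator U x * (volume_density X x * F (X x)) \<partial>lborel)"
    by (subst integral_restrict_space[OF U]) simp
  finally show "(\<integral>p. F p \<partial>chart_measure M U X) =
      (\<integral>x. indicator U x * (volume_density X x * F (X x)) \<partial>lborel)" .
qed

section \<open>Tangent spaces, gradient and second fundamental form\<close>

lemma has_vector_derivative_eventually_eq:
  assumes "\<forall>\<^sub>F t in nhds x. f t = g t" "(f has_vector_derivative v) (at x)"
  shows "(g has_vector_derivative v) (at x)"
  using has_vector_derivative_cong_ev[of UNIV f g x v] assms eventually_nhds_x_imp_x[OF assms(1)] by simp

text \<open>For small t the curve stays in \<open>M\<close> and in \<open>W\<close>, where
  \<open>F\<close> and \<open>G\<close> agree. So a derivative in a tangent direction depends only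
  on the values on \<open>M\<close>.\<close>

lemma curve_in_vector_derivative_unique:
  assumes c: "curve_in M p \<gamma> v" and eq: "\<And>q. q \<in> M \<inter> W \<Longrightarrow> F q = G q" and W: "open W" "p \<in> W" "p \<in> M"
    and F: "(F has_derivative F') (at p)" and G: "(G has_derivative G') (at p)"
  shows "F' v = G' v"
proof -
  have \<gamma>: "\<gamma> 0 = p" "\<forall>\<^sub>F t in nhds 0. \<gamma> t \<in> M" "(\<gamma> has_vector_derivative v) (at 0)"
    using c by (auto simp: curve_in_def)
  have comp: "((\<lambda>t. H (\<gamma> t)) has_vector_derivative H' v) (at 0)"
    if "(H has_derivative H') (at p)" for H H'
    using vector_derivative_diff_chain_within[OF \<gamma>(3), of H H'] that \<gamma>(1)
    by (auto simp: o_def intro: has_derivative_at_withinI)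
  have "isCont \<gamma> 0" using \<gamma>(3) by (rule has_vector_derivative_continuous)
  then have "\<forall>\<^sub>F t in nhds 0. \<gamma> t \<in> W"
    using W(1,2) \<gamma>(1) by (auto simp: continuous_at_open eventually_nhds) 
  with \<gamma>(2) have "\<forall>\<^sub>F t in nhds 0. F (\<gamma> t) = G (\<gamma> t)"
    by eventually_elim (auto intro: eq)
  then have "((\<lambda>t. G (\<gamma> t)) has_vector_derivative F' v) (at 0)"
    using comp[OF F] by (rule has_vector_derivative_eventually_eq)
  with comp[OF G] show ?thesis by (metis vector_derivative_unique_at)
qed

text \<open>On \<open>M\<close> near \<open>X x\<close> the identity equals \<open>X\<close> after
  \<open>Y\<close>, so every velocity lies in the range of the derivative of \<open>X\<close>;
  conversely, images of straight lines in \<open>U\<close> realize the whole range.\<close>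

lemma tangent_space_chart:
  assumes C: "adapted_chart M U X Y V" and x: "x \<in> U"
  shows "tangent_space M (X x) = range (frechet_derivative X (at x))"
proof -
  note D = adapted_chartD[OF C]
  have X: "(X has_derivative frechet_derivative X (at x)) (at x)" by (rule Ck_on_1_D(2)[OF D(3) x])
  have Y: "(Y has_derivative frechet_derivative Y (at (X x))) (at (X x))"
    by (rule adapted_chart_derivative(1)[OF C x])
  show ?thesis
  proof (intro set_eqI iffI)
    fix v assume "v \<in> tangent_space M (X x)"
    then obtain \<gamma> where c: "curve_in M (X x) \<gamma> v" by (auto simp: tangent_space_def)
    have "(\<lambda>v. v) v = frechet_derivative X (at x) (frechet_derivative Y (at (X x)) v)"
    proof (rule curve_in_vector_derivative_unique[OF c _ D(2) D(8)[OF x] D(7)[OF x]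
          has_derivative_ident])
      show "q = X (Y q)" if "q \<in> M \<inter> V" for q using D(10) that by auto
      show "((\<lambda>q. X (Y q)) has_derivative
          (\<lambda>v. frechet_derivative X (at x) (frechet_derivative Y (at (X x)) v))) (at (X x))"
        using diff_chain_at[OF Y, of X "frechet_derivative X (at x)"] X D(6)[OF x] by (simp add: o_def)
    qed
    then show "v \<in> range (frechet_derivative X (at x))" by auto
  next
    fix v assume "v \<in> range (frechet_derivative X (at x))"
    then obtain w where w: "v = frechet_derivative X (at x) w" by auto
    have "((\<lambda>t. x + t *\<^sub>R w) has_vector_derivative w) (at 0)"
      by (auto intro!: derivative_eq_intros simp: has_vector_derivative_def)
    then have "((\<lambda>t. X (x + t *\<^sub>R w)) has_vector_derivative v) (at 0)"
      using vector_derivative_diff_chain_within[of "\<lambda>t. x + t *\<^sub>R w" w 0 UNIV X "frechet_derivative X (at x)"] X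
      by (simp add: o_def w has_derivative_at_withinI)
    moreover have "\<forall>\<^sub>F t in nhds 0. x + t *\<^sub>R w \<in> U"
    proof -
      have "isCont (\<lambda>t. x + t *\<^sub>R w) 0" by (intro continuous_intros)
      then show ?thesis using D(1) x by (auto simp: continuous_at_open eventually_nhds)
    qed
    then have "\<forall>\<^sub>F t in nhds 0. X (x + t *\<^sub>R w) \<in> M"
      by (rule eventually_mono) (rule D(7))
    ultimately have "curve_in M (X x) (\<lambda>t. X (x + t *\<^sub>R w)) v"
      by (simp add: curve_in_def)
    then show "v \<in> tangent_space M (X x)" by (auto simp: tangent_space_def)
  qed
qed

section \<open>The surface gradient\<close>

lemma smooth_on_has_derivative:
  assumes "smooth_on g W" "p \<in> W"
  shows "(g has_derivative frechet_derivative g (at p)) (at p)"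
proof -
  have "Ck_on 1 g W" using assms(1) unfolding smooth_on_def by blast
  then show ?thesis using assms(2) by (rule Ck_on_1_D(2))
qed

lemma smooth_function_on_has_vector_derivative:
  assumes f: "smooth_function_on M f" and p: "p \<in> M"
  obtains D where "linear D"
    "\<And>\<gamma> w. curve_in M p \<gamma> w \<Longrightarrow> ((\<lambda>t. f (\<gamma> t)) has_real_derivative D w) (at 0)"
proof -
  obtain W g where W: "open W" "p \<in> W" "smooth_on g W" "\<And>q. q \<in> M \<inter> W \<Longrightarrow> f q = g q"
    using bspec[OF f[unfolded smooth_function_on_def] p] by metis
  define D where "D = frechet_derivative g (at p)"
  have g: "(g has_derivative D) (at p)" unfolding D_def by (rule smooth_on_has_derivative[OF W(3,2)])
  show ?thesis
  proof (rule that)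
    show "linear D" using g by (rule has_derivative_linear)
    fix \<gamma> w assume c: "curve_in M p \<gamma> w"
    have \<gamma>: "\<gamma> 0 = p" "\<forall>\<^sub>F t in nhds 0. \<gamma> t \<in> M" "(\<gamma> has_vector_derivative w) (at 0)"
      using c by (auto simp: curve_in_def)
    have "((\<lambda>t. g (\<gamma> t)) has_vector_derivative D w) (at 0)"
      using vector_derivative_diff_chain_within[OF \<gamma>(3), of g D] g \<gamma>(1)
      by (auto simp: o_def intro: has_derivative_at_withinI)
    moreover have "isCont \<gamma> 0" using \<gamma>(3) by (rule has_vector_derivative_continuous)
    then have "\<forall>\<^sub>F t in nhds 0. \<gamma> t \<in> W"
      using W(1,2) \<gamma>(1) by (auto simp: continuous_at_open eventually_nhds)
    with \<gamma>(2) have "\<forall>\<^sub>F t in nhds 0. g (\<gamma> t) = f (\<gamma> t)"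
      by eventually_elim (auto simp: W(4))
    ultimately have "((\<lambda>t. f (\<gamma> t)) has_vector_derivative D w) (at 0)"
      by (rule has_vector_derivative_eventually_eq[rotated])
    then show "((\<lambda>t. f (\<gamma> t)) has_real_derivative D w) (at 0)"
      by (simp add: has_real_derivative_iff_has_vector_derivative)
  qed
qed

text \<open>The description is met by projecting orthogonally to the tangent space the vector that
  represents the derivative of f as an ambient linear functional. It is unique because the
  difference of two candidates is itself the velocity of a curve, hence orthogonal to
  itself.\<close>

lemma surface_gradient_works:
  assumes T: "subspace (tangent_space M p)" and f: "smooth_function_on M f" and p: "p \<in> M"
    and c: "curve_in M p \<gamma> w"
  shows "((\<lambda>t. f (\<gamma> t)) has_real_derivative (surface_gradient M f p \<bullet> w)) (at 0)"
proof -
  obtain D where D: "linear D"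
    "\<And>\<gamma> w. curve_in M p \<gamma> w \<Longrightarrow> ((\<lambda>t. f (\<gamma> t)) has_real_derivative D w) (at 0)"
    using smooth_function_on_has_vector_derivative[OF f p] by blast
  let ?P = "\<lambda>v. v \<in> tangent_space M p \<and>
    (\<forall>\<gamma> w. curve_in M p \<gamma> w \<longrightarrow> ((\<lambda>t. f (\<gamma> t)) has_real_derivative (v \<bullet> w)) (at 0))"
  define a where "a = adjoint D 1"
  have a: "a \<bullet> w = D w" for w
    using adjoint_works[OF D(1), of w 1] by (simp add: a_def inner_commute)
  obtain y z where yz: "y \<in> span (tangent_space M p)"
    "\<And>w. w \<in> span (tangent_space M p) \<Longrightarrow> orthogonal z w" "a = y + z"
    using orthogonal_subspace_decomp_exists[of "tangent_space M p" a] by blast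
  have y: "y \<in> tangent_space M p" using yz(1) T by (metis span_eq_iff)
  have yD: "y \<bullet> w = D w" if "w \<in> tangent_space M p" for w
    using a[of w] yz(2)[of w] yz(3) that by (simp add: span_base orthogonal_def inner_add_left)
  have Py: "?P y"
  proof (intro conjI allI impI y)
    fix \<gamma> w assume c: "curve_in M p \<gamma> w"
    then have "y \<bullet> w = D w" by (intro yD) (auto simp: tangent_space_def)
    then show "((\<lambda>t. f (\<gamma> t)) has_real_derivative (y \<bullet> w)) (at 0)"
      using D(2)[OF c] by simp
  qed
  have "v = y" if v: "?P v" for v
  proof -
    have "v - y \<in> tangent_space M p" using v y T by (simp add: subspace_diff)
    then obtain \<gamma> where "curve_in M p \<gamma> (v - y)" by (auto simp: tangent_space_def)
    then have "v \<bullet> (v - y) = y \<bullet> (v - y)" using v Py by (metis DERIV_unique)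
    then have "(v - y) \<bullet> (v - y) = 0" by (simp add: inner_diff_left)
    then show ?thesis by simp
  qed
  with Py have "?P (surface_gradient M f p)"
    unfolding surface_gradient_def by (intro theI[of ?P]) auto
  with c show ?thesis by blast
qed

section \<open>Unit normals and the second fundamental form of a hypersurface\<close>

lemma range_eq_orthogonal_complement:
  fixes L :: "real^'n::finite \<Rightarrow> 'n ambient"
  assumes L: "linear L" "inj L" and n: "n \<noteq> 0" "\<And>v. n \<bullet> L v = 0"
  shows "range L = {v. n \<bullet> v = 0}"
proof (rule subspace_dim_equal)
  show "subspace (range L)" using L(1) by (simp add: linear_subspace_image)
  show "subspace {v. n \<bullet> v = 0}" by (rule subspace_hyperplane)
  show "range L \<subseteq> {v. n \<bullet> v = 0}" using n by auto
  have "dim (range L) = CARD('n)"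
    using dim_image_eq[OF L(1), of UNIV] L(2) by simp
  then show "dim {v. n \<bullet> v = 0} \<le> dim (range L)"
    using n(1) by (simp add: dim_hyperplane)
qed

text \<open>Two unit normals agree up to a locally constant sign, and tangential derivatives of a
  map are determined by its values on the hypersurface.\<close>

lemma unit_normal_derivative_unique:
  assumes W: "open W" "p \<in> W" "p \<in> M"
    and N1: "Ck_on 1 N1 W" "\<And>q. q \<in> M \<inter> W \<Longrightarrow> norm (N1 q) = 1"
      "\<And>q. q \<in> M \<inter> W \<Longrightarrow> tangent_space M q = {v. N1 q \<bullet> v = 0}"
    and N2: "local_unit_normal M p N2"
  obtains c :: real where "c\<^sup>2 = 1"
    "\<And>v. v \<in> tangent_space M p \<Longrightarrow>
      frechet_derivative N2 (at p) v = c *\<^sub>R frechet_derivative N1 (at p) v"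
proof -
  obtain W' where W': "open W'" "p \<in> W'" "Ck_on 1 N2 W'"
    "\<And>q. q \<in> M \<inter> W' \<Longrightarrow> norm (N2 q) = 1" "\<And>q v. q \<in> M \<inter> W' \<Longrightarrow> v \<in> tangent_space M q \<Longrightarrow> N2 q \<bullet> v = 0"
    using N2 unfolding local_unit_normal_def by blast
  \<comment> \<open>The relative sign of the two normals: continuous, with values 1 and -1 on
    \<open>M\<close>.\<close>
  define s where "s = (\<lambda>q. N2 q \<bullet> N1 q)"
  have eq: "N2 q = s q *\<^sub>R N1 q" and s1: "(s q)\<^sup>2 = 1" if q: "q \<in> M \<inter> (W \<inter> W')" for q
  proof -
    have n1: "N1 q \<bullet> N1 q = 1" using N1(2)[of q] q by (simp add: norm_eq_1)
    have n2: "N2 q \<bullet> N2 q = 1" using W'(4)[of q] q by (simp add: norm_eq_1)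
    \<comment> \<open>\<open>w\<close> is orthogonal to \<open>N1\<close>, hence tangent, hence
      orthogonal to \<open>N2\<close> as well; so it is orthogonal to itself.\<close>
    define w where "w = N2 q - s q *\<^sub>R N1 q"
    have *: "N1 q \<bullet> w = 0" by (simp add: w_def inner_diff_right n1 s_def inner_commute)
    then have "N2 q \<bullet> w = 0" using N1(3)[of q] W'(5)[of q w] q by auto
    with * have "w \<bullet> w = 0" by (simp add: w_def inner_diff_left)
    then show e: "N2 q = s q *\<^sub>R N1 q" by (simp add: w_def)
    have "N2 q \<bullet> N2 q = (s q *\<^sub>R N1 q) \<bullet> (s q *\<^sub>R N1 q)" using e by metis
    then show "(s q)\<^sup>2 = 1" using n1 n2 by (simp add: power2_eq_square)
  qed
  have "continuous_on (W \<inter> W') s"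
    unfolding s_def using Ck_on_1_D(4)[OF N1(1)] Ck_on_1_D(4)[OF W'(3)]
    by (intro continuous_intros) (auto intro: continuous_on_subset)
  \<comment> \<open>In this neighbourhood \<open>s\<close> differs from \<open>s p\<close> by less
    than 1, while distinct signs differ by 2; so on \<open>M\<close> the normal \<open>N2\<close> is
    there a constant multiple of \<open>N1\<close>.\<close>
  then have "open ((W \<inter> W') \<inter> s -` ball (s p) 1)"
    by (rule continuous_open_preimage) (use W W' in auto)
  moreover have "N2 q = s p *\<^sub>R N1 q" if "q \<in> M \<inter> ((W \<inter> W') \<inter> s -` ball (s p) 1)" for q
  proof -
    have "(s q)\<^sup>2 = 1" "(s p)\<^sup>2 = 1" "\<bar>s p - s q\<bar> < 1"
      using that s1 W W' by (auto simp: dist_real_def)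
    then have "s q = s p" by (auto simp: power2_eq_1_iff)
    then show ?thesis using eq[of q] that by auto
  qed
  moreover have "(N2 has_derivative frechet_derivative N2 (at p)) (at p)"
    by (rule Ck_on_1_D(2)[OF W'(3,2)])
  moreover have "((\<lambda>q. s p *\<^sub>R N1 q) has_derivative
      (\<lambda>v. s p *\<^sub>R frechet_derivative N1 (at p) v)) (at p)"
    by (intro has_derivative_scaleR_right Ck_on_1_D(2)[OF N1(1) W(2)])
  moreover have "p \<in> (W \<inter> W') \<inter> s -` ball (s p) 1" using W W' by simp
  ultimately have "frechet_derivative N2 (at p) v = s p *\<^sub>R frechet_derivative N1 (at p) v"
    if "v \<in> tangent_space M p" for v
    using that curve_in_vector_derivative_unique[of M p _ v "(W \<inter> W') \<inter> s -` ball (s p) 1"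
          N2 "\<lambda>q. s p *\<^sub>R N1 q"] W(3) unfolding tangent_space_def by blast
  with s1[of p] W W' show ?thesis by (intro that[of "s p"]) auto
qed

text \<open>The shape operator below has the principal curvature \<open>\<kappa>\<close> on the complement of \<open>e\<close>
  and \<open>(1 - n) \<kappa>\<close> on \<open>e\<close>.\<close>

lemma norm_sq_second_fundamental_form_eq:
  fixes M :: "('n::finite) ambient set"
  defines "n \<equiv> real CARD('n)"
  assumes W: "open W" "p \<in> W" "p \<in> M"
    and N: "Ck_on 1 N W" "\<And>q. q \<in> M \<inter> W \<Longrightarrow> norm (N q) = 1"
      "\<And>q. q \<in> M \<inter> W \<Longrightarrow> tangent_space M q = {v. N q \<bullet> v = 0}"
    and e: "e \<in> tangent_space M p" "norm e = 1"
    and shape: "\<And>v. v \<in> tangent_space M p \<Longrightarrow>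
      frechet_derivative N (at p) v = \<kappa> *\<^sub>R (v - (n * (v \<bullet> e)) *\<^sub>R e)"
  shows "norm_sq_second_fundamental_form M p = \<kappa>\<^sup>2 * (n * (n - 1))"
proof -
  let ?T = "tangent_space M p"
  have T_eq: "?T = {v. N p \<bullet> v = 0}" using N(3) W by auto
  then have T: "subspace ?T" by (simp add: subspace_hyperplane)
  have "N p \<noteq> 0" using N(2)[of p] W by auto
  then have dimT: "dim ?T = CARD('n)" unfolding T_eq by (simp add: dim_hyperplane)
  have "local_unit_normal M p N"
    unfolding local_unit_normal_def using W N by (intro exI[of _ W]) auto
  then have "local_unit_normal M p (SOME N. local_unit_normal M p N)"
    by (rule someI[of "local_unit_normal M p"])
  from unit_normal_derivative_unique[OF W N this]
  obtain c :: real where c: "c\<^sup>2 = 1"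
    "\<And>v. v \<in> ?T \<Longrightarrow> frechet_derivative (SOME N. local_unit_normal M p N) (at p) v =
        c *\<^sub>R frechet_derivative N (at p) v"
    by blast
  define B where "B = (SOME B. orthonormal_basis_of ?T B)"
  have "\<exists>B. orthonormal_basis_of ?T B"
    using orthonormal_basis_subspace[OF T] unfolding orthonormal_basis_of_def by metis
  then have "orthonormal_basis_of ?T B" unfolding B_def by (rule someI_ex)
  then have B: "B \<subseteq> ?T" "pairwise orthogonal B" "\<And>b. b \<in> B \<Longrightarrow> norm b = 1" "span B = ?T"
    by (auto simp: orthonormal_basis_of_def)
  have indep: "independent B"
    using B(3)[of 0] by (intro pairwise_orthogonal_independent[OF B(2)]) auto
  have fin: "finite B" using indep by (rule independent_imp_finite)
  have card: "card B = CARD('n)"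
    using dim_eq_card_independent[OF indep] dim_span[of B] B(4) dimT by simp
  \<comment> \<open>The basis is an unknown one picked by \<open>SOME\<close>. Parseval removes it
    from the inner sum here and from the outer sum at the end.\<close>
  have parseval: "(\<Sum>w\<in>B. (u \<bullet> w)\<^sup>2) = u \<bullet> u" if "u \<in> ?T" for u
  proof -
    have "(\<Sum>w\<in>B. (u \<bullet> w) *\<^sub>R w) = u"
      using that B fin by (intro orthonormal_basis_expand) auto
    then have "u \<bullet> u = u \<bullet> (\<Sum>w\<in>B. (u \<bullet> w) *\<^sub>R w)" by simp
    also have "\<dots> = (\<Sum>w\<in>B. (u \<bullet> w)\<^sup>2)" by (simp add: inner_sum_right power2_eq_square)
    finally show ?thesis by simp
  qed
  have ee: "e \<bullet> e = 1" using e(2) by (simp add: norm_eq_1)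
  have "(\<Sum>w\<in>B. (second_fundamental_form M p v w)\<^sup>2) = \<kappa>\<^sup>2 * (1 + (n\<^sup>2 - 2 * n) * (e \<bullet> v)\<^sup>2)"
    if v: "v \<in> B" for v
  proof -
    have vT: "v \<in> ?T" using v B(1) by auto
    define u where "u = v - (n * (v \<bullet> e)) *\<^sub>R e"
    have uT: "u \<in> ?T" unfolding u_def using vT e(1) T by (intro subspace_diff subspace_scale)
    have "(second_fundamental_form M p v w)\<^sup>2 = \<kappa>\<^sup>2 * (u \<bullet> w)\<^sup>2" for w
      unfolding second_fundamental_form_def c(2)[OF vT] shape[OF vT] u_def[symmetric]
      using c(1) by (simp add: power_mult_distrib)
    then have "(\<Sum>w\<in>B. (second_fundamental_form M p v w)\<^sup>2) = \<kappa>\<^sup>2 * (u \<bullet> u)"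
      by (simp add: parseval[OF uT] flip: sum_distrib_left)
    also have "u \<bullet> u = 1 + (n\<^sup>2 - 2 * n) * (e \<bullet> v)\<^sup>2"
      using B(3)[OF v] ee
      by (simp add: u_def inner_diff_left inner_diff_right norm_eq_1 inner_commute
          power2_eq_square algebra_simps)
    finally show ?thesis .
  qed
  then have "norm_sq_second_fundamental_form M p =
      (\<Sum>v\<in>B. \<kappa>\<^sup>2 * (1 + (n\<^sup>2 - 2 * n) * (e \<bullet> v)\<^sup>2))"
    unfolding norm_sq_second_fundamental_form_def B_def[symmetric] Let_def by simp
  \<comment> \<open>The bracket is n + (n^2 - 2 n) |e|^2 = n (n - 1), that is, n - 1 directions
    contributing 1 and one contributing (n - 1)^2.\<close>
  also have "\<dots> = \<kappa>\<^sup>2 * (real (card B) + (n\<^sup>2 - 2 * n) * (\<Sum>v\<in>B. (e \<bullet> v)\<^sup>2))"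
    by (simp add: sum.distrib flip: sum_distrib_left)
  also have "\<dots> = \<kappa>\<^sup>2 * (n * (n - 1))"
    unfolding parseval[OF e(1)] ee card n_def by (simp add: power2_eq_square algebra_simps)
  finally show ?thesis .
qed

section \<open>Integration along lines and the Hardy inequality\<close>

lemma lborel_translation:
  fixes f :: "'a::euclidean_space \<Rightarrow> real"
  assumes "f \<in> borel_measurable borel"
  shows "(\<integral>x. f (x + c) \<partial>lborel) = (\<integral>x. f x \<partial>lborel)"
    and "integrable lborel (\<lambda>x. f (x + c)) \<longleftrightarrow> integrable lborel f"
proof -
  have "(\<integral>x. f x \<partial>lborel) = (\<integral>x. f x \<partial>distr lborel borel ((+) c))"
    by (simp add: lborel_distr_plus)
  also have "\<dots> = (\<integral>x. f (c + x) \<partial>lborel)"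
    using assms by (intro integral_distr) auto
  finally show "(\<integral>x. f (x + c) \<partial>lborel) = (\<integral>x. f x \<partial>lborel)" by (simp add: add.commute)
  have "integrable lborel f \<longleftrightarrow> integrable (distr lborel borel ((+) c)) f"
    by (simp add: lborel_distr_plus)
  also have "\<dots> \<longleftrightarrow> integrable lborel (\<lambda>x. f (c + x))"
    using assms by (intro integrable_distr_eq) auto
  finally show "integrable lborel (\<lambda>x. f (x + c)) \<longleftrightarrow> integrable lborel f" by (simp add: add.commute)
qed

text \<open>For \<open>F\<close> supported in the slab \<open>\<bar>x \<bullet> e\<bar> < S\<close>, the shear \<open>(x, t) \<mapsto> (x + t e, t)\<close> shows that
  \<open>2 S\<close> times the integral of \<open>F\<close> is the integral over \<open>x\<close> in the slab of the line integrals of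
  \<open>F\<close> in direction \<open>e\<close>; this replaces a splitting of the Lebesgue measure along \<open>e\<close>.\<close>

lemma integral_nonneg_if_line_integrals_nonneg:
  fixes F :: "'a::euclidean_space \<Rightarrow> real"
  assumes F: "integrable lborel F" and e: "norm e = 1"
    and supp: "\<And>x. \<not> \<bar>x \<bullet> e\<bar> < S \<Longrightarrow> F x = 0"
    and line: "\<And>x. x \<bullet> e = 0 \<Longrightarrow> 0 \<le> (\<integral>t. F (x + t *\<^sub>R e) \<partial>lborel)"
  shows "0 \<le> (\<integral>x. F x \<partial>lborel)"
proof (cases "0 < S")
  case False
  then have "F x = 0" for x using supp[of x] by linarith
  then show ?thesis by simp
next
  case S: True
  have Fm [measurable]: "F \<in> borel_measurable borel"
    using borel_measurable_integrable[OF F] by simp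
  \<comment> \<open>Moving x along \<open>e\<close> only translates the line integral, so the base
    point can be put on the hyperplane orthogonal to \<open>e\<close>.\<close>
  have line': "0 \<le> (\<integral>t. F (x + t *\<^sub>R e) \<partial>lborel)" for x
  proof -
    have "(\<lambda>t. F (x - (x \<bullet> e) *\<^sub>R e + t *\<^sub>R e)) \<in> borel_measurable borel" by measurable
    from lborel_translation(1)[OF this, of "x \<bullet> e"]
    have "(\<integral>t. F (x + t *\<^sub>R e) \<partial>lborel) = (\<integral>t. F (x - (x \<bullet> e) *\<^sub>R e + t *\<^sub>R e) \<partial>lborel)"
      by (simp add: algebra_simps)
    then show ?thesis using line[of "x - (x \<bullet> e) *\<^sub>R e"] e by (simp add: inner_diff_left norm_eq_1)
  qed
  \<comment> \<open>\<open>I\<close> is the window that restricts x to the slab; \<open>G\<close>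
    and \<open>H\<close> are the same function before and after the shear.\<close>
  define I :: "real \<Rightarrow> real" where "I = indicator {-S<..<S}"
  have [measurable]: "I \<in> borel_measurable borel" by (simp add: I_def)
  have I01: "0 \<le> I t" "I t \<le> 1" for t by (auto simp: I_def indicator_def)
  define G where "G = (\<lambda>t x. I (x \<bullet> e) * F (x + t *\<^sub>R e))"
  define H where "H = (\<lambda>t y. I (y \<bullet> e - t) * F y)"
  have GH: "G t x = H t (x + t *\<^sub>R e)" for t x
    using e by (simp add: G_def H_def inner_add_left norm_eq_1)
  have [measurable]: "case_prod G \<in> borel_measurable (lborel \<Otimes>\<^sub>M lborel)"
    "case_prod H \<in> borel_measurable (lborel \<Otimes>\<^sub>M lborel)"
    unfolding G_def H_def by measurable
  have Hm [measurable]: "H t \<in> borel_measurable borel" for t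
    unfolding H_def by measurable
  have Hint: "integrable lborel (H t)" for t
    unfolding H_def using F
    by (rule Bochner_Integration.integrable_bound)
      (use I01 in \<open>auto simp: abs_mult intro!: mult_left_le_one_le\<close>)
  have Gint: "integrable lborel (G t)" for t
    unfolding GH using lborel_translation(2)[OF Hm] Hint by blast
  define A where "A = (\<lambda>t. \<integral>y. \<bar>H t y\<bar> \<partial>lborel)"
  have A_G: "A t = (\<integral>x. \<bar>G t x\<bar> \<partial>lborel)" for t
    unfolding A_def GH by (rule lborel_translation(1)[symmetric]) measurable
  \<comment> \<open>The window forces |y . e - t| < S and the support of \<open>F\<close> forces |y
    . e| < S, so only |t| <= 2 S contributes. This bounded range of t yields integrability on the
    product, as Fubini demands.\<close>
  have A_bound: "\<bar>A t\<bar> \<le> indicator {-2*S..2*S} t * (\<integral>y. \<bar>F y\<bar> \<partial>lborel)" for t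
  proof (cases "t \<in> {-2*S..2*S}")
    case True
    have "A t \<le> (\<integral>y. \<bar>F y\<bar> \<partial>lborel)"
      unfolding A_def using Hint F
      by (intro integral_mono integrable_abs)
        (use I01 in \<open>auto simp: H_def abs_mult intro!: mult_left_le_one_le\<close>)
    moreover have "0 \<le> A t" by (simp add: A_def)
    ultimately show ?thesis using True by simp
  next
    case False
    have "H t y = 0" for y
      using supp[of y] False by (cases "\<bar>y \<bullet> e\<bar> < S") (auto simp: H_def I_def indicator_def)
    then show ?thesis using False by (simp add: A_def)
  qed
  have A_int: "integrable lborel A"
  proof (rule Bochner_Integration.integrable_bound)
    show "integrable lborel (\<lambda>t. indicator {-2*S..2*S} t * (\<integral>y. \<bar>F y\<bar> \<partial>lborel))"
      by (intro integrable_mult_left) (simp add: emeasure_lborel_Icc_eq)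
    show "A \<in> borel_measurable lborel"
      unfolding A_def by measurable
    show "AE t in lborel. norm (A t) \<le> norm (indicator {-2*S..2*S} t * (\<integral>y. \<bar>F y\<bar> \<partial>lborel))"
      using A_bound by (auto intro: order_trans[OF _ abs_ge_self])
  qed
  have prod_int: "integrable (lborel \<Otimes>\<^sub>M lborel) (case_prod G)"
    "integrable (lborel \<Otimes>\<^sub>M lborel) (case_prod H)"
    using A_int Gint Hint by (auto intro!: lborel_pair.Fubini_integrable simp: A_G[symmetric] A_def)
  have "0 \<le> (\<integral>x. (\<integral>t. G t x \<partial>lborel) \<partial>lborel)"
    using line' I01 by (intro integral_nonneg_AE) (simp add: G_def)
  also have "\<dots> = (\<integral>t. (\<integral>x. G t x \<partial>lborel) \<partial>lborel)"
    by (rule lborel_pair.Fubini_integral[OF prod_int(1)])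
  also have "\<dots> = (\<integral>t. (\<integral>y. H t y \<partial>lborel) \<partial>lborel)"
    unfolding GH by (intro Bochner_Integration.integral_cong refl lborel_translation(1) Hm)
  also have "\<dots> = (\<integral>y. (\<integral>t. H t y \<partial>lborel) \<partial>lborel)"
    by (rule lborel_pair.Fubini_integral[OF prod_int(2), symmetric])
  also have "\<dots> = (\<integral>y. 2 * S * F y \<partial>lborel)"
  proof (rule Bochner_Integration.integral_cong[OF refl])
    fix y
    have "(\<lambda>t. I (y \<bullet> e - t)) = indicator {y \<bullet> e - S<..<y \<bullet> e + S}"
      by (auto simp: I_def indicator_def fun_eq_iff)
    moreover have "(\<integral>t. H t y \<partial>lborel) = (\<integral>t. I (y \<bullet> e - t) \<partial>lborel) * F y"
      unfolding H_def by simp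
    ultimately show "(\<integral>t. H t y \<partial>lborel) = 2 * S * F y"
      using S by simp
  qed
  finally show ?thesis using S by (simp add: zero_le_mult_iff)
qed

text \<open>The integral of \<open>Q'\<close> is taken in the gauge sense, where every derivative is
  integrable with the expected value. This suits the application, in which \<open>Q'\<close>
  contains a meridian derivative of f whose continuity is never established.\<close>

lemma integral_nonneg_if_ge_derivative:
  fixes G Q :: "real \<Rightarrow> real"
  assumes ab: "a \<le> b"
    and outside: "\<And>s. s \<notin> {a..b} \<Longrightarrow> 0 \<le> G s"
    and Q: "\<And>s. s \<in> {a..b} \<Longrightarrow> (Q has_real_derivative Q' s) (at s)" "Q a = 0" "Q b = 0"
    and le: "\<And>s. s \<in> {a..b} \<Longrightarrow> Q' s \<le> G s"
  shows "0 \<le> (\<integral>s. G s \<partial>lborel)"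
proof (cases "integrable lborel G")
  case False
  then show ?thesis by (simp add: not_integrable_integral_eq)
next
  case True
  have si: "set_integrable lborel {a..b} G"
    unfolding set_integrable_def using True by (intro integrable_mult_indicator) auto
  have "(Q' has_integral (Q b - Q a)) {a..b}"
    using ab Q(1)
    by (intro fundamental_theorem_of_calculus)
      (auto intro: has_field_derivative_at_within simp flip: has_real_derivative_iff_has_vector_derivative)
  then have "integral {a..b} Q' = 0" "Q' integrable_on {a..b}"
    using Q by (auto simp: has_integral_iff)
  moreover have "G integrable_on {a..b}" using set_borel_integral_eq_integral(1)[OF si] .
  ultimately have "0 \<le> integral {a..b} G"
    using integral_le[of Q' "{a..b}" G] le by auto
  also have "\<dots> = (\<integral>s. indicator {a..b} s *\<^sub>R G s \<partial>lborel)"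
    using set_borel_integral_eq_integral(2)[OF si] by (simp add: set_lebesgue_integral_def)
  also have "\<dots> \<le> (\<integral>s. G s \<partial>lborel)"
    using si True outside by (intro integral_mono) (auto simp: set_integrable_def indicator_def)
  finally show ?thesis .
qed

text \<open>With \<open>q = (2 - n) \<phi>' / \<phi>\<close>, the profile equation turns into the Riccati equation
  \<open>q' + q\<^sup>2 = - (n - 1) (n - 2) / \<phi>\<^sup>2\<close>, so that
  \<open>h'\<^sup>2 - (n - 1) (n - 2) h\<^sup>2 / \<phi>\<^sup>2 = (h' - q h)\<^sup>2 + (q h\<^sup>2)'\<close>.\<close>

lemma catenoid_hardy_inequality:
  fixes G h h' \<phi> \<phi>' \<phi>'' :: "real \<Rightarrow> real"
  assumes ab: "a \<le> b" and C: "0 \<le> C"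
    and pos: "\<And>s. s \<in> {a..b} \<Longrightarrow> 0 < \<phi> s"
    and \<phi>: "\<And>s. s \<in> {a..b} \<Longrightarrow> (\<phi> has_real_derivative \<phi>' s) (at s)"
    and \<phi>': "\<And>s. s \<in> {a..b} \<Longrightarrow> (\<phi>' has_real_derivative \<phi>'' s) (at s)"
    and ode: "\<And>s. s \<in> {a..b} \<Longrightarrow> \<phi>'' s = (n - 1) * (1 + (\<phi>' s)\<^sup>2) / \<phi> s"
    and h: "\<And>s. s \<in> {a..b} \<Longrightarrow> (h has_real_derivative h' s) (at s)" "h a = 0" "h b = 0"
    and outside: "\<And>s. s \<notin> {a..b} \<Longrightarrow> 0 \<le> G s"
    and le: "\<And>s. s \<in> {a..b} \<Longrightarrow> C * ((h' s)\<^sup>2 - (n - 1) * (n - 2) * (h s)\<^sup>2 / (\<phi> s)\<^sup>2) \<le> G s"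
  shows "0 \<le> (\<integral>s. G s \<partial>lborel)"
proof -
  define q where "q = (\<lambda>s. (2 - n) * \<phi>' s / \<phi> s)"
  \<comment> \<open>The Riccati equation serves as the definition of \<open>q'\<close>;
    \<open>dq\<close> verifies it from the profile equation.\<close>
  define q' where "q' = (\<lambda>s. - (q s)\<^sup>2 - (n - 1) * (n - 2) / (\<phi> s)\<^sup>2)"
  have dq: "(q has_real_derivative q' s) (at s)" if s: "s \<in> {a..b}" for s
  proof -
    have "(q has_real_derivative ((2 - n) * \<phi>'' s * \<phi> s - (2 - n) * \<phi>' s * \<phi>' s) / (\<phi> s * \<phi> s)) (at s)"
      unfolding q_def using pos[OF s] \<phi>[OF s] \<phi>'[OF s]
      by (auto intro!: derivative_eq_intros)
    moreover have "((2 - n) * \<phi>'' s * \<phi> s - (2 - n) * \<phi>' s * \<phi>' s) / (\<phi> s * \<phi> s) = q' s"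
      using pos[OF s] unfolding q'_def q_def ode[OF s]
      by (simp add: field_simps power2_eq_square)
    ultimately show ?thesis by simp
  qed
  show ?thesis
  proof (rule integral_nonneg_if_ge_derivative[OF ab outside])
    fix s assume s: "s \<in> {a..b}"
    show "((\<lambda>s. C * (q s * (h s)\<^sup>2)) has_real_derivative
        C * (q' s * (h s)\<^sup>2 + 2 * q s * h s * h' s)) (at s)"
      using dq[OF s] h(1)[OF s] by (auto intro!: derivative_eq_intros)
    have "(h' s)\<^sup>2 - (n - 1) * (n - 2) * (h s)\<^sup>2 / (\<phi> s)\<^sup>2 =
        (h' s - q s * h s)\<^sup>2 + (q' s * (h s)\<^sup>2 + 2 * q s * h s * h' s)"
      unfolding q'_def by (simp add: power2_eq_square algebra_simps)
    then have "q' s * (h s)\<^sup>2 + 2 * q s * h s * h' s \<le>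
        (h' s)\<^sup>2 - (n - 1) * (n - 2) * (h s)\<^sup>2 / (\<phi> s)\<^sup>2" by simp
    then show "C * (q' s * (h s)\<^sup>2 + 2 * q s * h s * h' s) \<le> G s"
      using le[OF s] C by (meson mult_left_mono order_trans)
  qed (use h in auto)
qed

section \<open>Stereographic coordinates\<close>

text \<open>The projection stays inside \<open>real^'n\<close>: the n - 1 other entries carry the
  sphere parameter, and the k-th entry is free for s.\<close>

definition drop_coord :: "'n \<Rightarrow> real^'n::finite \<Rightarrow> real^'n" where
  "drop_coord k x = x - x $ k *\<^sub>R axis k 1"

lemma drop_coord_simps [simp]:
  "drop_coord k x $ k = 0" "drop_coord k x \<bullet> axis k 1 = 0" "axis k 1 \<bullet> drop_coord k x = 0"
  "drop_coord k (axis k 1) = 0" "drop_coord k (drop_coord k x) = drop_coord k x"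
  "drop_coord k 0 = 0"
  "drop_coord k (x + y) = drop_coord k x + drop_coord k y"
  "drop_coord k (c *\<^sub>R x) = c *\<^sub>R drop_coord k x"
  by (simp_all add: drop_coord_def vec_eq_iff inner_axis inner_axis' algebra_simps)

lemma bounded_linear_drop_coord: "bounded_linear (drop_coord k)"
  unfolding linear_conv_bounded_linear[symmetric] by (rule linearI) simp_all

lemma drop_coord_inner_self: "drop_coord k x \<bullet> drop_coord k x = x \<bullet> x - (x $ k)\<^sup>2"
  by (simp add: drop_coord_def inner_diff_left inner_diff_right inner_axis inner_axis'
      power2_eq_square algebra_simps)

lemma drop_coord_add_back: "drop_coord k x + x $ k *\<^sub>R axis k 1 = x"
  by (simp add: drop_coord_def)

text \<open>Stereographic projection from the pole \<open>\<sigma> e\<^sub>k\<close>, for \<open>\<sigma> = \<plusminus>1\<close>; the coordinate \<open>x $ k\<close>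
  does not enter and is left free for the parameter \<open>s\<close> of the profile curve.\<close>

definition stereo :: "'n \<Rightarrow> real \<Rightarrow> real^'n::finite \<Rightarrow> real^'n" where
  "stereo k \<sigma> x = inverse (1 + drop_coord k x \<bullet> drop_coord k x) *\<^sub>R
     (2 *\<^sub>R drop_coord k x + (\<sigma> * (drop_coord k x \<bullet> drop_coord k x - 1)) *\<^sub>R axis k 1)"

text \<open>The unsimplified outcome of the product rule. Later arguments use its continuity, its
  invariance under shifts along \<open>axis k 1\<close>, its vanishing on that vector and its
  orthogonality to \<open>stereo\<close>.\<close>

definition stereo_deriv :: "'n \<Rightarrow> real \<Rightarrow> real^'n::finite \<Rightarrow> real^'n \<Rightarrow> real^'n" where
  "stereo_deriv k \<sigma> x v = inverse (1 + drop_coord k x \<bullet> drop_coord k x) *\<^sub>R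
     (2 *\<^sub>R drop_coord k v + (\<sigma> * (2 * (drop_coord k x \<bullet> drop_coord k v))) *\<^sub>R axis k 1)
     - (inverse (1 + drop_coord k x \<bullet> drop_coord k x) * (2 * (drop_coord k x \<bullet> drop_coord k v))
         * inverse (1 + drop_coord k x \<bullet> drop_coord k x)) *\<^sub>R
     (2 *\<^sub>R drop_coord k x + (\<sigma> * (drop_coord k x \<bullet> drop_coord k x - 1)) *\<^sub>R axis k 1)"

text \<open>With \<open>norm y\<close> in place of the radius 1 the map is invariant under positive
  scaling, so it recovers the sphere parameter directly from phi(s) w.\<close>

definition stereo_inv :: "'n \<Rightarrow> real \<Rightarrow> real^'n::finite \<Rightarrow> real^'n" where
  "stereo_inv k \<sigma> y = inverse (norm y - \<sigma> * y $ k) *\<^sub>R drop_coord k y"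

lemma one_plus_inner_self_pos: "0 < 1 + (z :: 'a::real_inner) \<bullet> z"
  by (simp add: add_pos_nonneg)

lemma stereo_has_derivative: "(stereo k \<sigma> has_derivative stereo_deriv k \<sigma> x) (at x)"
proof -
  have z: "(drop_coord k has_derivative drop_coord k) (at x)"
    by (rule bounded_linear_imp_has_derivative[OF bounded_linear_drop_coord])
  have nz: "1 + drop_coord k x \<bullet> drop_coord k x \<noteq> 0"
    using one_plus_inner_self_pos[of "drop_coord k x"] by simp
  have zz: "((\<lambda>x. drop_coord k x \<bullet> drop_coord k x) has_derivative
      (\<lambda>v. 2 * (drop_coord k x \<bullet> drop_coord k v))) (at x)"
    by (rule has_derivative_eq_rhs[OF has_derivative_inner[OF z z]])
      (simp add: fun_eq_iff inner_commute)
  have i: "((\<lambda>x. inverse (1 + drop_coord k x \<bullet> drop_coord k x)) has_derivative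
      (\<lambda>v. - (inverse (1 + drop_coord k x \<bullet> drop_coord k x) *
        (2 * (drop_coord k x \<bullet> drop_coord k v)) *
        inverse (1 + drop_coord k x \<bullet> drop_coord k x)))) (at x)"
    by (rule Deriv.has_derivative_inverse[where f="\<lambda>x. 1 + drop_coord k x \<bullet> drop_coord k x", OF nz],
        rule has_derivative_eq_rhs[OF has_derivative_add[OF has_derivative_const zz]], simp)
  have b: "((\<lambda>x. 2 *\<^sub>R drop_coord k x + (\<sigma> * (drop_coord k x \<bullet> drop_coord k x - 1)) *\<^sub>R axis k 1)
      has_derivative (\<lambda>v. 2 *\<^sub>R drop_coord k v + (\<sigma> * (2 * (drop_coord k x \<bullet> drop_coord k v))) *\<^sub>R axis k 1)) (at x)"
    by (rule has_derivative_eq_rhs[OF has_derivative_add[OF has_derivative_scaleR_right[OF z]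
            has_derivative_scaleR_left[OF has_derivative_mult_right[OF
                has_derivative_diff[OF zz has_derivative_const]]]]]) simp
  show ?thesis
    unfolding stereo_def[abs_def] stereo_deriv_def[abs_def]
    by (rule has_derivative_eq_rhs[OF has_derivative_scaleR[OF i b]]) (simp add: fun_eq_iff)
qed

lemma continuous_on_stereo_deriv: "continuous_on S (\<lambda>x. stereo_deriv k \<sigma> x v)"
proof -
  have "1 + drop_coord k x \<bullet> drop_coord k x \<noteq> 0" for x
    using one_plus_inner_self_pos[of "drop_coord k x"] by simp
  then show ?thesis
    unfolding stereo_deriv_def
    by (intro continuous_intros bounded_linear.continuous_on[OF bounded_linear_drop_coord]) auto
qed

lemma continuous_on_stereo: "continuous_on S (stereo k \<sigma>)"
  by (meson stereo_has_derivative has_derivative_continuous continuous_at_imp_continuous_on)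

lemma stereo_shift [simp]:
  "stereo k \<sigma> (x + t *\<^sub>R axis k 1) = stereo k \<sigma> x"
  "stereo_deriv k \<sigma> (x + t *\<^sub>R axis k 1) = stereo_deriv k \<sigma> x"
  "stereo_deriv k \<sigma> x (axis k 1) = 0"
  "stereo k \<sigma> (drop_coord k x) = stereo k \<sigma> x"
  by (simp_all add: stereo_def stereo_deriv_def fun_eq_iff)

lemma stereo_nth: "stereo k \<sigma> x $ k =
    \<sigma> * (drop_coord k x \<bullet> drop_coord k x - 1) / (1 + drop_coord k x \<bullet> drop_coord k x)"
  by (simp add: stereo_def divide_inverse mult.commute)

lemma norm_stereo:
  assumes "\<sigma>\<^sup>2 = 1"
  shows "norm (stereo k \<sigma> x) = 1"
proof -
  let ?z = "drop_coord k x"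
  have "stereo k \<sigma> x \<bullet> stereo k \<sigma> x =
      (4 * (?z \<bullet> ?z) + \<sigma>\<^sup>2 * (?z \<bullet> ?z - 1)\<^sup>2) / (1 + ?z \<bullet> ?z)\<^sup>2"
    unfolding stereo_def
    by (simp add: inner_add_left inner_add_right inner_axis_axis power2_eq_square divide_simps)
  also have "4 * (?z \<bullet> ?z) + \<sigma>\<^sup>2 * (?z \<bullet> ?z - 1)\<^sup>2 = (1 + ?z \<bullet> ?z)\<^sup>2"
    unfolding assms by (simp add: power2_eq_square algebra_simps)
  also have "(1 + ?z \<bullet> ?z)\<^sup>2 / (1 + ?z \<bullet> ?z)\<^sup>2 = 1"
    using one_plus_inner_self_pos[of ?z] by simp
  finally show ?thesis by (simp add: norm_eq_1)
qed

lemma stereo_inv_stereo: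
  assumes \<sigma>: "\<sigma>\<^sup>2 = 1" and c: "0 < c"
  shows "stereo_inv k \<sigma> (c *\<^sub>R stereo k \<sigma> x) = drop_coord k x"
    and "norm (c *\<^sub>R stereo k \<sigma> x) \<noteq> \<sigma> * (c *\<^sub>R stereo k \<sigma> x) $ k"
proof -
  let ?z = "drop_coord k x"
  note pos = one_plus_inner_self_pos[of ?z]
  have s1: "1 - \<sigma> * stereo k \<sigma> x $ k = 2 / (1 + ?z \<bullet> ?z)"
    using pos \<sigma> by (simp add: stereo_nth field_simps power2_eq_square)
  have n: "norm (c *\<^sub>R stereo k \<sigma> x) - \<sigma> * (c *\<^sub>R stereo k \<sigma> x) $ k = c * (2 / (1 + ?z \<bullet> ?z))"
    unfolding s1[symmetric] using norm_stereo[OF \<sigma>] c by (simp add: algebra_simps)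
  have p: "0 < c * (2 / (1 + ?z \<bullet> ?z))" using pos c by simp
  with n show "norm (c *\<^sub>R stereo k \<sigma> x) \<noteq> \<sigma> * (c *\<^sub>R stereo k \<sigma> x) $ k" by linarith
  have d: "drop_coord k (c *\<^sub>R stereo k \<sigma> x) = (c * (2 / (1 + ?z \<bullet> ?z))) *\<^sub>R ?z"
    by (simp add: stereo_def divide_inverse)
  show "stereo_inv k \<sigma> (c *\<^sub>R stereo k \<sigma> x) = ?z"
    unfolding stereo_inv_def n d scaleR_scaleR using p by (metis left_inverse less_irrefl scaleR_one)
qed

text \<open>With d = 1 - sigma w_k, the unit length of w gives |z|^2 = (2 - d) / d for the projected
  point z, and both components of \<open>stereo\<close> follow from this value.\<close>

lemma stereo_stereo_inv:
  assumes \<sigma>: "\<sigma>\<^sup>2 = 1" and c: "0 < c" and w: "norm w = 1" "1 \<noteq> \<sigma> * w $ k"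
  shows "stereo k \<sigma> (stereo_inv k \<sigma> (c *\<^sub>R w)) = w"
proof -
  define d where "d = 1 - \<sigma> * w $ k"
  have d: "d \<noteq> 0" using w by (simp add: d_def)
  define z where "z = inverse d *\<^sub>R drop_coord k w"
  have "norm (c *\<^sub>R w) - \<sigma> * (c *\<^sub>R w) $ k = c * d"
    using c w by (simp add: d_def algebra_simps)
  then have inv: "stereo_inv k \<sigma> (c *\<^sub>R w) = z"
    unfolding stereo_inv_def z_def using c by simp
  have wk: "\<sigma> * w $ k = 1 - d" by (simp add: d_def)
  have "(w $ k)\<^sup>2 = (\<sigma> * w $ k)\<^sup>2" using \<sigma> by (simp add: power_mult_distrib)
  then have "(w $ k)\<^sup>2 = (1 - d)\<^sup>2" by (simp add: wk)
  then have "drop_coord k w \<bullet> drop_coord k w = d * (2 - d)"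
    using w(1) by (simp add: drop_coord_inner_self norm_eq_1 power2_eq_square algebra_simps)
  then have zz: "z \<bullet> z = (2 - d) / d" using d by (simp add: z_def field_simps)
  then have "1 + z \<bullet> z = 2 / d" using d by (simp add: field_simps)
  then have i: "inverse (1 + z \<bullet> z) = d / 2" by simp
  have "w $ k = \<sigma> * (\<sigma> * w $ k)" using \<sigma> by (simp add: power2_eq_square mult.assoc[symmetric])
  then have k: "w $ k = \<sigma> * (1 - d)" by (simp only: wk)
  have dz: "drop_coord k z = z" by (simp add: z_def)
  have "stereo k \<sigma> z = (d / 2) *\<^sub>R (2 *\<^sub>R z + (\<sigma> * (z \<bullet> z - 1)) *\<^sub>R axis k 1)"
    unfolding stereo_def dz i ..
  also have "\<dots> = d *\<^sub>R z + (\<sigma> * (1 - d)) *\<^sub>R axis k 1"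
  proof -
    have "d / 2 * (\<sigma> * (z \<bullet> z - 1)) = \<sigma> * (1 - d)"
      using d by (simp add: zz field_simps)
    then show ?thesis by (simp add: scaleR_add_right)
  qed
  also have "\<dots> = w"
    unfolding k[symmetric] using d by (simp add: z_def drop_coord_add_back)
  finally show ?thesis unfolding inv .
qed

lemma stereo_inv_differentiable:
  assumes "norm y \<noteq> \<sigma> * y $ k"
  shows "stereo_inv k \<sigma> differentiable (at y)"
proof -
  have "y \<noteq> 0" using assms by auto
  then have 1: "(\<lambda>y. norm y) differentiable (at y)" by (rule differentiable_norm_at)
  have 2: "(\<lambda>y. y $ k) differentiable (at y)"
    by (rule bounded_linear_imp_differentiable[OF bounded_linear_vec_nth])
  have 3: "drop_coord k differentiable (at y)"
    by (rule bounded_linear_imp_differentiable[OF bounded_linear_drop_coord])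
  show ?thesis
    unfolding stereo_inv_def[abs_def] using assms 1 2 3
    by (intro differentiable_scaleR differentiable_inverse differentiable_diff differentiable_mult) auto
qed

section \<open>The catenoid\<close>

text \<open>The second derivative in the third assumption is the profile equation solved for phi''.
  \<open>T\<close> and \<open>a\<close> make up the rigid motion, and \<open>k\<close> selects the
  axis on which the poles of the stereographic charts lie.\<close>

locale catenoid =
  fixes k :: "'n::finite" and S :: real and \<phi> \<phi>' :: "real \<Rightarrow> real"
    and T :: "'n ambient \<Rightarrow> 'n ambient" and a :: "'n ambient" and n :: real
  assumes pos: "\<And>s. \<bar>s\<bar> < S \<Longrightarrow> 0 < \<phi> s"
    and d\<phi>: "\<And>s. \<bar>s\<bar> < S \<Longrightarrow> (\<phi> has_real_derivative \<phi>' s) (at s)"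
    and d\<phi>': "\<And>s. \<bar>s\<bar> < S \<Longrightarrow>
      (\<phi>' has_real_derivative (n - 1) * (1 + (\<phi>' s)\<^sup>2) / \<phi> s) (at s)"
    and T: "orthogonal_transformation T"
    and n3: "3 \<le> CARD('n)" and n_eq: "n = real CARD('n)"
begin

abbreviation e\<^sub>k :: "real^'n" where "e\<^sub>k \<equiv> axis k 1"

definition M :: "'n ambient set" where
  "M = (\<lambda>(s, w). T (\<phi> s *\<^sub>R w, s) + a) ` ({s. \<bar>s\<bar> < S} \<times> sphere 0 1)"

definition W :: "real \<Rightarrow> real" where "W s = sqrt (1 + (\<phi>' s)\<^sup>2)"

text \<open>Undoes the rigid motion: on \<open>M\<close> the first component becomes the radial
  vector phi(s) w and the second the height s.\<close>

definition pull :: "'n ambient \<Rightarrow> 'n ambient" where "pull q = inv T (q - a)"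

definition U :: "(real^'n) set" where "U = {x. \<bar>x $ k\<bar> < S}"

definition X :: "real \<Rightarrow> real^'n \<Rightarrow> 'n ambient" where
  "X \<sigma> x = T (\<phi> (x $ k) *\<^sub>R stereo k \<sigma> x, x $ k) + a"

definition DX :: "real \<Rightarrow> real^'n \<Rightarrow> real^'n \<Rightarrow> 'n ambient" where
  "DX \<sigma> x v = T ((\<phi>' (x $ k) * v $ k) *\<^sub>R stereo k \<sigma> x + \<phi> (x $ k) *\<^sub>R stereo_deriv k \<sigma> x v, v $ k)"

definition Y :: "real \<Rightarrow> 'n ambient \<Rightarrow> real^'n" where
  "Y \<sigma> q = stereo_inv k \<sigma> (fst (pull q)) + snd (pull q) *\<^sub>R e\<^sub>k"

text \<open>For sigma = 1 or -1, the first condition removes the closed ray from the origin through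
  the pole sigma e_k, including the origin itself.\<close>

definition V :: "real \<Rightarrow> 'n ambient set" where
  "V \<sigma> = {q. norm (fst (pull q)) \<noteq> \<sigma> * fst (pull q) $ k \<and> \<bar>snd (pull q)\<bar> < S}"

definition VN :: "'n ambient set" where
  "VN = {q. fst (pull q) \<noteq> 0 \<and> \<bar>snd (pull q)\<bar> < S}"

text \<open>The normal (w, -phi'(s)) / W(s) at (phi(s) w, s), extended off \<open>M\<close> so as to
  be constant along the horizontal rays that issue from the axis of rotation.\<close>

definition N :: "'n ambient \<Rightarrow> 'n ambient" where
  "N q = T (inverse (W (snd (pull q))) *\<^sub>R (inverse (norm (fst (pull q))) *\<^sub>R fst (pull q)),
      - (inverse (W (snd (pull q))) * \<phi>' (snd (pull q))))"

section \<open>The rigid motion and the profile curve\<close>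

lemma linear_T: "linear T"
  using T by (rule orthogonal_transformation_linear)

lemma bounded_linear_T: "bounded_linear T"
  using linear_T by (simp add: linear_conv_bounded_linear)

lemma T_inner: "T u \<bullet> T v = u \<bullet> v"
  using T unfolding orthogonal_transformation_def by blast

lemma T_inv [simp]: "T (inv T v) = v" "inv T (T v) = v"
  using orthogonal_transformation_bij[OF T] by (simp_all add: bij_is_surj surj_f_inv_f bij_is_inj inv_f_f)

lemma bounded_linear_inv_T: "bounded_linear (inv T)"
  using orthogonal_transformation_linear[OF orthogonal_transformation_inv[OF T]]
  by (simp add: linear_conv_bounded_linear)

lemma pull_T [simp]: "pull (T v + a) = v"
  by (simp add: pull_def)

lemma pull_has_derivative: "(pull has_derivative inv T) (at q)"
  unfolding pull_def[abs_def]
  using bounded_linear.has_derivative[OF bounded_linear_inv_T has_derivative_diff[OF has_derivative_ident has_derivative_const]]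
  by simp

lemma continuous_on_pull: "continuous_on A pull"
  by (meson pull_has_derivative has_derivative_continuous continuous_at_imp_continuous_on)

lemma W_pos: "0 < W s" and W_sq: "(W s)\<^sup>2 = 1 + (\<phi>' s)\<^sup>2" and W_mult: "W s * W s = 1 + (\<phi>' s)\<^sup>2"
  by (simp_all add: W_def add_pos_nonneg)

lemma W_deriv:
  assumes s: "\<bar>s\<bar> < S"
  shows "(W has_real_derivative (n - 1) * \<phi>' s * W s / \<phi> s) (at s)"
proof -
  have p: "0 < 1 + (\<phi>' s)\<^sup>2" by (simp add: add_pos_nonneg)
  have "(W has_real_derivative (2 * \<phi>' s * ((n - 1) * (1 + (\<phi>' s)\<^sup>2) / \<phi> s)) * (inverse (W s) / 2)) (at s)"
    unfolding W_def[abs_def] using p d\<phi>'[OF s]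
    by (auto intro!: derivative_eq_intros)
  moreover have "(2 * \<phi>' s * ((n - 1) * (1 + (\<phi>' s)\<^sup>2) / \<phi> s)) * (inverse (W s) / 2)
      = (n - 1) * \<phi>' s * W s / \<phi> s"
    using W_pos[of s] pos[OF s] unfolding W_sq[symmetric] by (simp add: field_simps power2_eq_square)
  ultimately show ?thesis by (rule DERIV_cong)
qed

lemma inverse_W_deriv:
  assumes s: "\<bar>s\<bar> < S"
  shows "((\<lambda>s. inverse (W s)) has_real_derivative - ((n - 1) * \<phi>' s / (\<phi> s * W s))) (at s)"
proof -
  have "((\<lambda>s. inverse (W s)) has_real_derivative
      - (inverse (W s) * ((n - 1) * \<phi>' s * W s / \<phi> s) * inverse (W s))) (at s)"
    using W_deriv[OF s] W_pos[of s] by (auto intro!: derivative_eq_intros)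
  moreover have "- (inverse (W s) * ((n - 1) * \<phi>' s * W s / \<phi> s) * inverse (W s)) =
      - ((n - 1) * \<phi>' s / (\<phi> s * W s))"
    using W_pos[of s] pos[OF s] by (simp add: field_simps)
  ultimately show ?thesis by (rule DERIV_cong)
qed

text \<open>By \<open>W_deriv\<close> and \<open>d\<phi>\<close>, phi^(n-1) and W have the same
  logarithmic derivative (n - 1) phi' / phi.\<close>

lemma first_integral:
  obtains C where "0 \<le> C" "\<forall>s. \<bar>s\<bar> < S \<longrightarrow> \<phi> s ^ (CARD('n) - 1) / W s = C"
proof -
  obtain m where m: "CARD('n) - 1 = Suc m" "n - 1 = real (Suc m)"
    using n3 by (cases "CARD('n) - 1") (auto simp: n_eq)
  have "((\<lambda>s. \<phi> s ^ (CARD('n) - 1) / W s) has_real_derivative 0) (at s)" if s: "\<bar>s\<bar> < S" for s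
  proof -
    have "((\<lambda>s. \<phi> s ^ Suc m / W s) has_real_derivative
        (real (Suc m) * \<phi>' s * \<phi> s ^ m * W s - \<phi> s ^ Suc m * (real (Suc m) * \<phi>' s * W s / \<phi> s)) / (W s * W s)) (at s)"
      using W_deriv[OF s] d\<phi>[OF s] W_pos[of s] unfolding m
      by (auto intro!: derivative_eq_intros simp del: of_nat_Suc power_Suc) 
    moreover have "real (Suc m) * \<phi>' s * \<phi> s ^ m * W s - \<phi> s ^ Suc m * (real (Suc m) * \<phi>' s * W s / \<phi> s) = 0"
      using pos[OF s] by (simp del: of_nat_Suc add: field_simps)
    ultimately show ?thesis unfolding m by simp
  qed
  then have "\<And>s. s \<in> {-S<..<S} \<Longrightarrow>
      ((\<lambda>s. \<phi> s ^ (CARD('n) - 1) / W s) has_real_derivative 0) (at s within {-S<..<S})"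
    by (auto intro: has_field_derivative_at_within)
  then have "\<exists>c. \<forall>s\<in>{-S<..<S}. \<phi> s ^ (CARD('n) - 1) / W s = c"
    by (intro has_field_derivative_zero_constant) auto
  then obtain c where c: "\<And>s. s \<in> {-S<..<S} \<Longrightarrow> \<phi> s ^ (CARD('n) - 1) / W s = c" by metis
  show ?thesis
  \<comment> \<open>The absolute value secures a nonnegative constant also when S <= 0, where the
    interval is empty and \<open>c\<close> arbitrary.\<close>
  proof (rule that[of "\<bar>c\<bar>"])
    have "\<phi> s ^ (CARD('n) - 1) / W s = \<bar>c\<bar>" if s: "\<bar>s\<bar> < S" for s
    proof -
      have "0 \<le> \<phi> s ^ (CARD('n) - 1) / W s" using pos[OF s] W_pos[of s] by simp
      moreover have "s \<in> {-S<..<S}" using s by (simp add: abs_less_iff)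
      ultimately show ?thesis using c by simp
    qed
    then show "\<forall>s. \<bar>s\<bar> < S \<longrightarrow> \<phi> s ^ (CARD('n) - 1) / W s = \<bar>c\<bar>" by blast
  qed simp
qed

lemma continuous_on_profile:
  "continuous_on {s. \<bar>s\<bar> < S} \<phi>" "continuous_on {s. \<bar>s\<bar> < S} \<phi>'" "continuous_on {s. \<bar>s\<bar> < S} W"
  using d\<phi> d\<phi>' W_deriv
  by (auto intro!: continuous_at_imp_continuous_on DERIV_isCont)

section \<open>The stereographic charts of the catenoid\<close>

lemma open_U: "open U"
  unfolding U_def by (intro open_Collect_less continuous_intros)

lemma X_has_derivative:
  assumes x: "x \<in> U"
  shows "(X \<sigma> has_derivative DX \<sigma> x) (at x)"
proof -
  have s: "\<bar>x $ k\<bar> < S" using x by (simp add: U_def)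
  have nth: "((\<lambda>x. x $ k) has_derivative (\<lambda>v. v $ k)) (at x)"
    by (rule bounded_linear_imp_has_derivative[OF bounded_linear_vec_nth])
  have "((\<lambda>x. (\<phi> (x $ k) *\<^sub>R stereo k \<sigma> x, x $ k)) has_derivative
      (\<lambda>v. (\<phi> (x $ k) *\<^sub>R stereo_deriv k \<sigma> x v + (v $ k * \<phi>' (x $ k)) *\<^sub>R stereo k \<sigma> x, v $ k))) (at x)"
    by (intro has_derivative_Pair has_derivative_scaleR nth stereo_has_derivative
        DERIV_compose_FDERIV[where f=\<phi> and g="\<lambda>x. x $ k", OF d\<phi>[OF s]])
  from has_derivative_add[OF bounded_linear.has_derivative[OF bounded_linear_T this] has_derivative_const[of a]]
  show ?thesis unfolding X_def[abs_def] DX_def[abs_def] by (simp add: add.commute mult.commute)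
qed

lemma frechet_X: "x \<in> U \<Longrightarrow> frechet_derivative (X \<sigma>) (at x) = DX \<sigma> x"
  by (rule frechet_derivative_at[symmetric]) (rule X_has_derivative)

lemma continuous_on_compose_profile:
  assumes "continuous_on A g" "\<And>x. x \<in> A \<Longrightarrow> \<bar>g x\<bar> < S"
  shows "continuous_on A (\<lambda>x. \<phi> (g x))" "continuous_on A (\<lambda>x. \<phi>' (g x))" "continuous_on A (\<lambda>x. W (g x))"
  using assms by (auto intro!: continuous_on_compose2[OF continuous_on_profile(1)]
      continuous_on_compose2[OF continuous_on_profile(2)] continuous_on_compose2[OF continuous_on_profile(3)])

lemma Ck_X: "Ck_on 1 (X \<sigma>) U"
proof (rule Ck_on_1_I[OF open_U X_has_derivative])
  fix v
  have "continuous_on U (\<lambda>x. x $ k)" by (intro continuous_intros)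
  then show "continuous_on U (\<lambda>x. DX \<sigma> x v)"
    unfolding DX_def
    by (intro continuous_intros bounded_linear.continuous_on[OF bounded_linear_T]
        continuous_on_compose_profile continuous_on_stereo continuous_on_stereo_deriv)
      (auto simp: U_def)
qed

lemma X_in_M:
  assumes "\<sigma>\<^sup>2 = 1" "x \<in> U"
  shows "X \<sigma> x \<in> M"
  unfolding M_def X_def using assms norm_stereo[OF assms(1), of k x]
  by (intro image_eqI[of _ _ "(x $ k, stereo k \<sigma> x)"]) (auto simp: U_def)

lemma open_V: "open (V \<sigma>)"
  unfolding V_def
  by (intro open_Collect_conj open_Collect_neq open_Collect_less continuous_intros continuous_on_pull)

lemma adapted_chart_X:
  assumes \<sigma>: "\<sigma>\<^sup>2 = 1"
  shows "adapted_chart M U (X \<sigma>) (Y \<sigma>) (V \<sigma>)"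
  unfolding adapted_chart_def
proof (intro conjI ballI open_U open_V Ck_X)
  have pX: "pull (X \<sigma> x) = (\<phi> (x $ k) *\<^sub>R stereo k \<sigma> x, x $ k)" for x
    by (simp add: X_def)
  show YX: "Y \<sigma> (X \<sigma> x) = x" if x: "x \<in> U" for x
  proof -
    have "0 < \<phi> (x $ k)" using x pos by (simp add: U_def)
    from stereo_inv_stereo(1)[OF \<sigma> this, of k x] show ?thesis
      by (simp add: Y_def pX drop_coord_add_back)
  qed
  show "Y \<sigma> differentiable (at q)" if q: "q \<in> V \<sigma>" for q
  proof -
    have f: "((\<lambda>q. fst (pull q)) has_derivative (\<lambda>v. fst (inv T v))) (at q)"
      by (rule bounded_linear.has_derivative[OF bounded_linear_fst pull_has_derivative])
    have s: "((\<lambda>q. snd (pull q)) has_derivative (\<lambda>v. snd (inv T v))) (at q)"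
      by (rule bounded_linear.has_derivative[OF bounded_linear_snd pull_has_derivative])
    have "stereo_inv k \<sigma> differentiable (at (fst (pull q)))"
      using q by (intro stereo_inv_differentiable) (simp add: V_def)
    then obtain D where D: "(stereo_inv k \<sigma> has_derivative D) (at (fst (pull q)))"
      by (auto simp: differentiable_def)
    from has_derivative_add[OF has_derivative_compose[OF f D] has_derivative_scaleR_left[OF s]]
    show ?thesis
      unfolding Y_def[abs_def] differentiable_def by blast
  qed
  show "X \<sigma> ` U = M \<inter> V \<sigma>"
  proof (intro set_eqI iffI)
    fix q assume "q \<in> X \<sigma> ` U"
    then obtain x where x: "x \<in> U" "q = X \<sigma> x" by auto
    have "0 < \<phi> (x $ k)" using x pos by (simp add: U_def)
    from stereo_inv_stereo(2)[OF \<sigma> this, of k x] show "q \<in> M \<inter> V \<sigma>"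
      using x X_in_M[OF \<sigma>] by (simp add: V_def pX U_def)
  next
    fix q assume "q \<in> M \<inter> V \<sigma>"
    then obtain s w where sw: "\<bar>s\<bar> < S" "norm w = 1" "q = T (\<phi> s *\<^sub>R w, s) + a" and q: "q \<in> V \<sigma>"
      by (auto simp: M_def)
    have p: "0 < \<phi> s" using pos sw by simp
    have "1 \<noteq> \<sigma> * w $ k" using q sw p by (auto simp: V_def)
    from stereo_stereo_inv[OF \<sigma> p sw(2) this] have w: "stereo k \<sigma> (stereo_inv k \<sigma> (\<phi> s *\<^sub>R w)) = w" .
    have "Y \<sigma> q $ k = s" by (simp add: Y_def sw(3) stereo_inv_def)
    moreover have "stereo k \<sigma> (Y \<sigma> q) = w" using w by (simp add: Y_def sw(3))
    ultimately have "q = X \<sigma> (Y \<sigma> q)" "Y \<sigma> q \<in> U" using sw by (simp_all add: X_def U_def)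
    then show "q \<in> X \<sigma> ` U" by auto
  qed
qed

text \<open>A point missed by both charts would have a radial vector y with |y| = y_k = - y_k, hence
  y = 0, whereas phi is positive.\<close>

lemma M_cover: "M \<subseteq> V 1 \<union> V (-1)"
proof
  fix q assume "q \<in> M"
  then obtain s w where sw: "\<bar>s\<bar> < S" "norm w = 1" "q = T (\<phi> s *\<^sub>R w, s) + a"
    by (auto simp: M_def)
  then have "pull q = (\<phi> s *\<^sub>R w, s)" "norm (\<phi> s *\<^sub>R w) > 0" using pos[of s] by auto
  then show "q \<in> V 1 \<union> V (-1)" using sw by (auto simp: V_def)
qed

lemma M_chart:
  assumes "q \<in> M"
  obtains \<sigma> x where "\<sigma>\<^sup>2 = 1" "x \<in> U" "q = X \<sigma> x"
proof -
  have "q \<in> X 1 ` U \<or> q \<in> X (-1) ` U"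
    using assms M_cover adapted_chartD(5)[OF adapted_chart_X] by fastforce
  then show ?thesis using that[of 1] that[of "-1"] by auto
qed

text \<open>The first chart misses the meridian through its pole. In the second chart this is the
  line through 0 along \<open>axis k 1\<close>, contained in the hyperplane x_j = 0 for any other
  index j.\<close>

lemma null_pole_line: "{x \<in> U. X (-1) x \<notin> V 1} \<in> null_sets lborel"
proof -
  obtain j where j: "j \<noteq> k"
  proof -
    have "\<not> UNIV \<subseteq> {k}" using card_mono[of "{k}" "UNIV :: 'n set"] n3 by auto
    then show ?thesis using that by auto
  qed
  have cl: "closed {x :: real^'n. x $ j = 0}" by (intro closed_Collect_eq continuous_intros)
  have "negligible {x :: real^'n. x $ j = 0}" by (rule negligible_standard_hyperplane_cart)
  then have hyper: "{x :: real^'n. x $ j = 0} \<in> null_sets lborel"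
    using cl by (simp add: negligible_iff_null_sets null_sets_def)
  have "open {x \<in> U. X (-1) x \<in> V 1}"
    using continuous_open_preimage[OF Ck_on_1_D(4)[OF Ck_X] open_U open_V, of "-1" 1]
    by (simp add: Int_def vimage_def)
  then have "U - {x \<in> U. X (-1) x \<in> V 1} \<in> sets lborel" using open_U by simp
  moreover have "U - {x \<in> U. X (-1) x \<in> V 1} = {x \<in> U. X (-1) x \<notin> V 1}" by auto
  ultimately have sets: "{x \<in> U. X (-1) x \<notin> V 1} \<in> sets lborel" by simp
  have sub: "{x \<in> U. X (-1) x \<notin> V 1} \<subseteq> {x. x $ j = 0}"
  proof
    fix x assume x: "x \<in> {x \<in> U. X (-1) x \<notin> V 1}"
    then have s: "\<bar>x $ k\<bar> < S" by (simp add: U_def)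
    let ?z = "drop_coord k x"
    have "\<phi> (x $ k) = \<phi> (x $ k) * stereo k (-1) x $ k"
      using x s pos[OF s] norm_stereo[of "-1" k x] by (simp add: V_def X_def)
    then have "stereo k (-1) x $ k = 1" using pos[OF s] by simp
    then have "?z \<bullet> ?z = 0"
      unfolding stereo_nth using one_plus_inner_self_pos[of ?z] by (simp add: field_simps)
    then have "?z $ j = 0" by simp
    then show "x \<in> {x. x $ j = 0}" using j by (simp add: drop_coord_def axis_def)
  qed
  show ?thesis by (rule null_sets_subset[OF hyper sets sub])
qed

lemma surface_measure_M: "surface_measure M = chart_measure M U (X 1)"
  by (rule surface_measure_eq_chart_measure[OF adapted_chart_X adapted_chart_X M_cover null_pole_line])
    simp_all

text \<open>The Gram matrix is \<open>D G D\<close> with \<open>D\<close> the diagonal matrix with entries \<open>W\<close> at \<open>k\<close> and \<open>\<phi>\<close> elsewhere,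
  and \<open>G\<close> the Gram matrix of a product metric, which does not depend on \<open>x $ k\<close>.\<close>

definition angular_density :: "real^'n \<Rightarrow> real" where
  "angular_density x = max 0 (sqrt (det (\<chi> i j. stereo_deriv k 1 x (axis i 1) \<bullet> stereo_deriv k 1 x (axis j 1)
     + (if i = k \<and> j = k then 1 else 0))))"

lemma angular_density_nonneg: "0 \<le> angular_density x" by (simp add: angular_density_def)

lemma angular_density_shift: "angular_density (x + t *\<^sub>R e\<^sub>k) = angular_density x" by (simp add: angular_density_def)

text \<open>Differentiation of the constant squared length 1.\<close>

lemma stereo_inner_deriv:
  assumes "\<sigma>\<^sup>2 = 1"
  shows "stereo k \<sigma> x \<bullet> stereo_deriv k \<sigma> x v = 0"
proof -
  have D: "((\<lambda>x. stereo k \<sigma> x \<bullet> stereo k \<sigma> x) has_derivative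
      (\<lambda>v. stereo k \<sigma> x \<bullet> stereo_deriv k \<sigma> x v + stereo_deriv k \<sigma> x v \<bullet> stereo k \<sigma> x)) (at x)"
    by (rule has_derivative_inner[OF stereo_has_derivative stereo_has_derivative])
  have const: "(\<lambda>x. stereo k \<sigma> x \<bullet> stereo k \<sigma> x) = (\<lambda>x. 1)"
    using norm_stereo[OF assms, of k] unfolding norm_eq_1 by simp
  have "(\<lambda>v. stereo k \<sigma> x \<bullet> stereo_deriv k \<sigma> x v + stereo_deriv k \<sigma> x v \<bullet> stereo k \<sigma> x) = (\<lambda>v. 0)"
    by (rule has_derivative_unique[OF D[unfolded const] has_derivative_const])
  from fun_cong[OF this, of v] show ?thesis by (simp add: inner_commute)
qed

lemma volume_density_X:
  assumes x: "x \<in> U"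
  shows "volume_density (X 1) x = W (x $ k) * \<phi> (x $ k) ^ (CARD('n) - 1) * angular_density x"
proof -
  let ?s = "x $ k"
  have s: "\<bar>?s\<bar> < S" using x by (simp add: U_def)
  define d where "d = (\<lambda>i. if i = k then W ?s else \<phi> ?s)"
  define D :: "real^'n^'n" where "D = (\<chi> i j. if i = j then d i else 0)"
  define G :: "real^'n^'n" where
    "G = (\<chi> i j. stereo_deriv k 1 x (axis i 1) \<bullet> stereo_deriv k 1 x (axis j 1) + (if i = k \<and> j = k then 1 else 0))"
  have st: "stereo k 1 x \<bullet> stereo k 1 x = 1" using norm_stereo[of 1 k x] by (simp add: norm_eq_1)
  have or: "stereo k 1 x \<bullet> stereo_deriv k 1 x v = 0" "stereo_deriv k 1 x v \<bullet> stereo k 1 x = 0" for v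
    using stereo_inner_deriv[of 1 x v] by (simp_all add: inner_commute)
  \<comment> \<open>The mixed terms vanish because \<open>stereo\<close> is a unit vector orthogonal
    to its derivatives. The entry at (k, k) is phi'^2 + 1 = W^2, since \<open>stereo_deriv\<close>
    kills \<open>axis k 1\<close>.\<close>
  have entry: "gram_matrix (X 1) x $ i $ j = d i * G $ i $ j * d j" for i j
  proof -
    have "gram_matrix (X 1) x $ i $ j =
      (\<phi>' ?s * axis i 1 $ k) * (\<phi>' ?s * axis j 1 $ k) +
        \<phi> ?s * (\<phi> ?s * (stereo_deriv k 1 x (axis i 1) \<bullet> stereo_deriv k 1 x (axis j 1))) +
      axis i 1 $ k * axis j 1 $ k"
      unfolding gram_matrix_def frechet_X[OF x] DX_def T_inner
      by (simp add: inner_add_left inner_add_right st or)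
    also have "\<dots> = d i * G $ i $ j * d j"
    proof -
      have "axis i 1 $ k = (if i = k then 1 else 0 :: real)" for i by (simp add: axis_def)
      then show ?thesis
        using W_mult[of ?s]
        by (cases "i = k"; cases "j = k") (simp_all add: d_def G_def algebra_simps power2_eq_square)
    qed
    finally show ?thesis .
  qed
  have gram: "gram_matrix (X 1) x = D ** G ** D"
    by (simp add: vec_eq_iff entry matrix_matrix_mult_def D_def if_distrib if_distribR
        sum.delta sum.delta' cong: if_cong)
  have detD: "det D = prod d UNIV"
    by (subst det_diagonal) (auto simp: D_def)
  have prod_d: "prod d UNIV = W ?s * \<phi> ?s ^ (CARD('n) - 1)"
  proof -
    have "prod d UNIV = d k * prod d (UNIV - {k})" by (rule prod.remove) auto
    also have "prod d (UNIV - {k}) = (\<Prod>i\<in>UNIV - {k}. \<phi> ?s)" by (rule prod.cong) (auto simp: d_def)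
    finally show ?thesis by (simp add: d_def card_Diff_singleton)
  qed
  have "sqrt (det (gram_matrix (X 1) x)) = (W ?s * \<phi> ?s ^ (CARD('n) - 1)) * sqrt (det G)"
  proof -
    have "det (gram_matrix (X 1) x) = (W ?s * \<phi> ?s ^ (CARD('n) - 1))\<^sup>2 * det G"
      unfolding gram det_mul detD prod_d by (simp add: power2_eq_square)
    then show ?thesis
      using W_pos[of ?s] pos[OF s] by (simp add: real_sqrt_mult real_sqrt_abs)
  qed
  moreover have "0 \<le> W ?s * \<phi> ?s ^ (CARD('n) - 1)"
    using W_pos[of ?s] pos[OF s] by simp
  ultimately show ?thesis
    unfolding volume_density_def angular_density_def G_def[symmetric] by (simp add: max_mult_distrib_left)
qed

section \<open>The unit normal and the principal curvatures of the catenoid\<close>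

lemma open_VN: "open VN"
  unfolding VN_def
  by (intro open_Collect_conj open_Collect_neq open_Collect_less continuous_intros continuous_on_pull)

text \<open>The raw product-rule derivative of \<open>N\<close>, with c' the derivative of 1/W. It
  is simplified only for tangent vectors at points of \<open>M\<close>, in
  \<open>norm_sq_A\<close>.\<close>

definition DN :: "'n ambient \<Rightarrow> 'n ambient \<Rightarrow> 'n ambient" where
  "DN q v = (let y = fst (pull q); s = snd (pull q); u = fst (inv T v); r = snd (inv T v);
       c' = - ((n - 1) * \<phi>' s / (\<phi> s * W s))
     in T (inverse (W s) *\<^sub>R (inverse (norm y) *\<^sub>R u - (inverse (norm y) * (y \<bullet> u / norm y) * inverse (norm y)) *\<^sub>R y)
         + (r * c') *\<^sub>R (inverse (norm y) *\<^sub>R y),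
       - (inverse (W s) * (r * ((n - 1) * (1 + (\<phi>' s)\<^sup>2) / \<phi> s)) + (r * c') * \<phi>' s)))"

lemma N_has_derivative:
  assumes q: "q \<in> VN"
  shows "(N has_derivative DN q) (at q)"
proof -
  have y: "fst (pull q) \<noteq> 0" and s: "\<bar>snd (pull q)\<bar> < S" using q by (auto simp: VN_def)
  have f: "((\<lambda>q. fst (pull q)) has_derivative (\<lambda>v. fst (inv T v))) (at q)"
    by (rule bounded_linear.has_derivative[OF bounded_linear_fst pull_has_derivative])
  have r: "((\<lambda>q. snd (pull q)) has_derivative (\<lambda>v. snd (inv T v))) (at q)"
    by (rule bounded_linear.has_derivative[OF bounded_linear_snd pull_has_derivative])
  have "((\<lambda>q. norm (fst (pull q))) has_derivative (\<lambda>v. (fst (pull q) \<bullet> fst (inv T v)) / norm (fst (pull q)))) (at q)"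
    using has_derivative_compose[OF f has_derivative_norm[OF y]]
    by (simp add: sgn_div_norm inner_commute divide_inverse mult.commute)
  then have i: "((\<lambda>q. inverse (norm (fst (pull q)))) has_derivative
      (\<lambda>v. - (inverse (norm (fst (pull q))) * ((fst (pull q) \<bullet> fst (inv T v)) / norm (fst (pull q)))
         * inverse (norm (fst (pull q)))))) (at q)"
    using y by (intro Deriv.has_derivative_inverse) auto
  show ?thesis
    unfolding N_def[abs_def]
    by (rule has_derivative_eq_rhs[OF bounded_linear.has_derivative[OF bounded_linear_T
          has_derivative_Pair[OF
            has_derivative_scaleR[OF DERIV_compose_FDERIV[where g="\<lambda>q. snd (pull q)", OF inverse_W_deriv[OF s] r]
              has_derivative_scaleR[OF i f]]
            has_derivative_minus[OF has_derivative_mult[OF DERIV_compose_FDERIV[where g="\<lambda>q. snd (pull q)", OF inverse_W_deriv[OF s] r]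
              DERIV_compose_FDERIV[where g="\<lambda>q. snd (pull q)", OF d\<phi>'[OF s] r]]]]]])
      (simp add: DN_def Let_def fun_eq_iff)
qed

lemma Ck_N: "Ck_on 1 N VN"
proof (rule Ck_on_1_I[OF open_VN N_has_derivative])
  fix v
  have f: "continuous_on VN (\<lambda>q. fst (pull q))" and s: "continuous_on VN (\<lambda>q. snd (pull q))"
    by (intro continuous_intros continuous_on_pull)+
  have nz: "fst (pull q) \<noteq> 0" "\<phi> (snd (pull q)) \<noteq> 0" "W (snd (pull q)) \<noteq> 0" if "q \<in> VN" for q
    using that pos[of "snd (pull q)"] W_pos[of "snd (pull q)"] by (auto simp: VN_def)
  have pr: "continuous_on VN (\<lambda>q. \<phi> (snd (pull q)))" "continuous_on VN (\<lambda>q. \<phi>' (snd (pull q)))"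
    "continuous_on VN (\<lambda>q. W (snd (pull q)))"
    by (rule continuous_on_compose_profile[OF s]; simp add: VN_def)+
  show "continuous_on VN (\<lambda>q. DN q v)"
    unfolding DN_def Let_def
    by (intro bounded_linear.continuous_on[OF bounded_linear_T] continuous_on_Pair continuous_on_add
        continuous_on_minus continuous_on_scaleR continuous_on_diff continuous_on_mult continuous_on_divide
        continuous_on_inverse continuous_on_norm continuous_on_inner continuous_on_power continuous_on_const
        f s pr) (auto simp: nz)
qed

lemma M_subset_VN: "M \<subseteq> VN"
  using pos by (auto simp: M_def VN_def) (metis less_irrefl norm_zero zero_neq_one)+

lemma pull_X: "pull (X \<sigma> x) = (\<phi> (x $ k) *\<^sub>R stereo k \<sigma> x, x $ k)"
  by (simp add: X_def)

lemma N_X: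
  assumes \<sigma>: "\<sigma>\<^sup>2 = 1" and x: "x \<in> U"
  shows "N (X \<sigma> x) = T (inverse (W (x $ k)) *\<^sub>R stereo k \<sigma> x, - (inverse (W (x $ k)) * \<phi>' (x $ k)))"
  using pos[of "x $ k"] x norm_stereo[OF \<sigma>, of k x] by (simp add: N_def pull_X U_def)

text \<open>The range of \<open>DX\<close> is orthogonal to \<open>N\<close> and, \<open>DX\<close>
  being injective, has dimension n; so it fills the whole hyperplane.\<close>

lemma N_unit_normal:
  assumes q: "q \<in> M"
  shows "norm (N q) = 1" "tangent_space M q = {v. N q \<bullet> v = 0}"
proof -
  obtain \<sigma> x where \<sigma>: "\<sigma>\<^sup>2 = 1" and x: "x \<in> U" and q: "q = X \<sigma> x" using M_chart[OF q] .
  let ?s = "x $ k"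
  note C = adapted_chart_X[OF \<sigma>]
  have st: "stereo k \<sigma> x \<bullet> stereo k \<sigma> x = 1" using norm_stereo[OF \<sigma>, of k x] by (simp add: norm_eq_1)
  have "N q \<bullet> N q = (inverse (W ?s))\<^sup>2 * (1 + (\<phi>' ?s)\<^sup>2)"
    unfolding q N_X[OF \<sigma> x] T_inner by (simp add: st power2_eq_square algebra_simps)
  also have "\<dots> = 1"
    using W_pos[of ?s] unfolding W_sq[symmetric] by (simp flip: power_mult_distrib)
  finally show N1: "norm (N q) = 1" by (simp add: norm_eq_1)
  have lin: "linear (DX \<sigma> x)" using X_has_derivative[OF x] by (rule has_derivative_linear)
  have "inj (DX \<sigma> x)"
    using adapted_chart_derivative(2)[OF C x] unfolding frechet_X[OF x] by (metis injI)
  moreover have "N q \<bullet> DX \<sigma> x v = 0" for v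
    unfolding q N_X[OF \<sigma> x] DX_def T_inner
    by (simp add: inner_add_right st stereo_inner_deriv[OF \<sigma>])
  ultimately have "range (DX \<sigma> x) = {v. N q \<bullet> v = 0}"
    using N1 by (intro range_eq_orthogonal_complement[OF lin]) auto
  then show "tangent_space M q = {v. N q \<bullet> v = 0}"
    using tangent_space_chart[OF C x] unfolding frechet_X[OF x] q by simp
qed

lemma norm_sq_A:
  assumes \<sigma>: "\<sigma>\<^sup>2 = 1" and x: "x \<in> U"
  shows "norm_sq_second_fundamental_form M (X \<sigma> x) = n * (n - 1) / (\<phi> (x $ k) * W (x $ k))\<^sup>2"
proof -
  define s where "s = x $ k"
  define w where "w = stereo k \<sigma> x"
  define p where "p = \<phi>' s"
  define f where "f = \<phi> s"
  define r where "r = W s"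
  let ?q = "X \<sigma> x"
  have s: "\<bar>s\<bar> < S" using x by (simp add: U_def s_def)
  have f0: "0 < f" using pos[OF s] by (simp add: f_def)
  have r0: "0 < r" and rr: "r * r = 1 + p * p"
    using W_pos[of s] W_mult[of s] by (simp_all add: r_def p_def power2_eq_square)
  have ww: "w \<bullet> w = 1" "norm w = 1" using norm_stereo[OF \<sigma>, of k x] by (simp_all add: norm_eq_1 w_def)
  have q: "?q \<in> M" by (rule X_in_M[OF \<sigma> x])
  have pq: "pull ?q = (f *\<^sub>R w, s)" by (simp add: pull_X f_def w_def s_def)
  have Nq: "N ?q = T (inverse r *\<^sub>R w, - (inverse r * p))"
    unfolding N_X[OF \<sigma> x] by (simp add: r_def w_def s_def p_def)
  \<comment> \<open>The unit tangent vector of the meridian, the principal direction with the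
    exceptional curvature.\<close>
  define e where "e = T ((p / r) *\<^sub>R w, 1 / r)"
  have "e \<bullet> e = (p * p + 1) / (r * r)"
    unfolding e_def T_inner using ww by (simp add: add_divide_distrib)
  also have "p * p + 1 = r * r" using rr by simp
  also have "r * r / (r * r) = 1" using r0 by simp
  finally have ne: "norm e = 1" by (simp add: norm_eq_1)
  have "N ?q \<bullet> e = 0" unfolding Nq e_def T_inner using ww by (simp add: divide_inverse)
  then have eT: "e \<in> tangent_space M ?q" using N_unit_normal(2)[OF q] by simp
  have shape: "frechet_derivative N (at ?q) v = (1 / (f * r)) *\<^sub>R (v - (n * (v \<bullet> e)) *\<^sub>R e)"
    if v: "v \<in> tangent_space M ?q" for v
  proof -
    obtain u t where ut: "inv T v = (u, t)" by (cases "inv T v")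
    then have v_eq: "v = T (u, t)" by (metis T_inv(1))
    have "N ?q \<bullet> v = 0" using v N_unit_normal(2)[OF q] by simp
    \<comment> \<open>Tangency to \<open>M\<close> reads w . u = p t, and then v . e is r t; both
      serve to eliminate u from the inner products.\<close>
    then have "inverse r * (w \<bullet> u - p * t) = 0"
      unfolding Nq v_eq T_inner by (simp add: algebra_simps)
    then have wu: "w \<bullet> u = p * t" using r0 by simp
    have "v \<bullet> e = (p * p + 1) * t / r"
      unfolding e_def v_eq T_inner using wu by (simp add: inner_commute add_divide_distrib distrib_right)
    also have "p * p + 1 = r * r" using rr by simp
    also have "r * r * t / r = r * t" using r0 by simp
    finally have ve: "v \<bullet> e = r * t" .
    have "?q \<in> VN" using q M_subset_VN by auto
    then have "frechet_derivative N (at ?q) v = DN ?q v"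
      by (simp add: frechet_derivative_at[OF N_has_derivative, symmetric])
    \<comment> \<open>Facts \<open>1\<close> and \<open>2\<close> are the horizontal and the
      vertical component. In \<open>1\<close> the projection contributes -p t and the derivative of
      1/W contributes -(n - 1) p t to the coefficient of \<open>w\<close>, together -n p t; in
      \<open>2\<close> the factor 1 + p^2 - p p collapses to 1.\<close>
    also have "\<dots> = T ((1 / (f * r)) *\<^sub>R ((u, t) - (n * (r * t)) *\<^sub>R ((p / r) *\<^sub>R w, 1 / r)))"
    proof -
      have 1: "inverse r *\<^sub>R (inverse (norm (f *\<^sub>R w)) *\<^sub>R u - (inverse (norm (f *\<^sub>R w)) *
            (f *\<^sub>R w \<bullet> u / norm (f *\<^sub>R w)) * inverse (norm (f *\<^sub>R w))) *\<^sub>R f *\<^sub>R w)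
         + (t * - ((n - 1) * p / (f * r))) *\<^sub>R (inverse (norm (f *\<^sub>R w)) *\<^sub>R f *\<^sub>R w)
         = (1 / (f * r)) *\<^sub>R (u - (n * (r * t)) *\<^sub>R ((p / r) *\<^sub>R w))"
      proof -
        have "inverse r *\<^sub>R (inverse (norm (f *\<^sub>R w)) *\<^sub>R u - (inverse (norm (f *\<^sub>R w)) *
            (f *\<^sub>R w \<bullet> u / norm (f *\<^sub>R w)) * inverse (norm (f *\<^sub>R w))) *\<^sub>R f *\<^sub>R w)
         + (t * - ((n - 1) * p / (f * r))) *\<^sub>R (inverse (norm (f *\<^sub>R w)) *\<^sub>R f *\<^sub>R w)
         = (1 / (f * r)) *\<^sub>R u + (- (p * t / (f * r)) - t * ((n - 1) * p / (f * r))) *\<^sub>R w"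
        proof -
          have "inverse f * (f * (p * t) * inverse f) * inverse f * f = p * t * inverse f"
            using f0 by simp
          then have "inverse r * (inverse f * (f * (p * t) * inverse f) * inverse f * f) =
              p * t * (inverse f * inverse r)"
            by simp
          then show ?thesis
            using f0 r0 ww(2) wu
            by (simp add: scaleR_diff_right scaleR_left_diff_distrib divide_inverse mult.commute[of "inverse r" "inverse f"])
        qed
        also have "- (p * t / (f * r)) - t * ((n - 1) * p / (f * r)) = - (n * p * t / (f * r))"
          using f0 r0 by (simp add: field_simps)
        finally show ?thesis using r0 by (simp add: scaleR_diff_right mult.commute mult.left_commute)
      qed
      have 2: "- (inverse r * (t * ((n - 1) * (1 + p\<^sup>2) / f)) + (t * - ((n - 1) * p / (f * r))) * p)
         = (1 / (f * r)) * (t - (n * (r * t)) * (1 / r))"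
      proof -
        have "- (inverse r * (t * ((n - 1) * (1 + p\<^sup>2) / f)) + (t * - ((n - 1) * p / (f * r))) * p)
          = - (t * (n - 1) * (1 + p\<^sup>2 - p * p)) / (f * r)"
          using f0 r0 by (simp add: field_simps)
        also have "\<dots> = (1 / (f * r)) * (t - (n * (r * t)) * (1 / r))"
          using f0 r0 by (simp add: power2_eq_square field_simps)
        finally show ?thesis .
      qed
      show ?thesis
        unfolding DN_def Let_def pq ut fst_conv snd_conv f_def[symmetric] p_def[symmetric] r_def[symmetric] 1 2
        by simp
    qed
    also have "\<dots> = (1 / (f * r)) *\<^sub>R (v - (n * (v \<bullet> e)) *\<^sub>R e)"
      unfolding ve unfolding v_eq e_def by (simp only: linear_cmul[OF linear_T] linear_diff[OF linear_T])
    finally show ?thesis .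
  qed
  have "norm_sq_second_fundamental_form M ?q = (1 / (f * r))\<^sup>2 * (n * (n - 1))"
    unfolding n_eq
    by (rule norm_sq_second_fundamental_form_eq[OF open_VN _ q Ck_N _ _ eT ne shape[unfolded n_eq]])
      (use q M_subset_VN N_unit_normal in auto)
  then show ?thesis by (simp add: f_def r_def s_def power_divide)
qed

end

section \<open>Meridians and the stability inequality\<close>

context catenoid
begin

definition meridian :: "real^'n \<Rightarrow> real \<Rightarrow> 'n ambient" where
  "meridian w s = T (\<phi> s *\<^sub>R w, s) + a"

lemma meridian_in_M: "norm w = 1 \<Longrightarrow> \<bar>s\<bar> < S \<Longrightarrow> meridian w s \<in> M"
  unfolding M_def meridian_def by (intro image_eqI[of _ _ "(s, w)"]) auto

lemma curve_in_meridian: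
  assumes w: "norm w = 1" and s: "\<bar>s\<bar> < S"
  shows "curve_in M (meridian w s) (\<lambda>t. meridian w (t + s)) (T (\<phi>' s *\<^sub>R w, 1))"
  unfolding curve_in_def
proof (intro conjI)
  have "(\<phi> has_derivative (\<lambda>h. \<phi>' s * h)) (at s)"
    using d\<phi>[OF s] by (simp add: has_field_derivative_def)
  then have "((\<lambda>t. (\<phi> t *\<^sub>R w, t)) has_derivative (\<lambda>h. ((\<phi>' s * h) *\<^sub>R w, h))) (at s)"
    by (intro has_derivative_Pair has_derivative_scaleR_left has_derivative_ident)
  from has_derivative_add[OF bounded_linear.has_derivative[OF bounded_linear_T this] has_derivative_const[of a]]
  have "(meridian w has_derivative (\<lambda>h. T ((\<phi>' s * h) *\<^sub>R w, h))) (at s)"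
    unfolding meridian_def[abs_def] by simp
  moreover have "((\<phi>' s * h) *\<^sub>R w, h) = h *\<^sub>R (\<phi>' s *\<^sub>R w, 1)" for h
    by (simp add: mult.commute)
  ultimately have "(meridian w has_vector_derivative T (\<phi>' s *\<^sub>R w, 1)) (at s)"
    by (simp add: has_vector_derivative_def linear_cmul[OF linear_T] del: scaleR_Pair)
  moreover have "((\<lambda>t. t + s) has_vector_derivative 1) (at 0)"
    by (auto intro!: derivative_eq_intros)
  ultimately show "((\<lambda>t. meridian w (t + s)) has_vector_derivative T (\<phi>' s *\<^sub>R w, 1)) (at 0)"
    using vector_diff_chain_at[of "\<lambda>t. t + s" 1 0 "meridian w"] by (simp add: o_def)
  have "open {t. \<bar>t + s\<bar> < S}" by (intro open_Collect_less continuous_intros)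
  then have "\<forall>\<^sub>F t in nhds 0. t \<in> {t. \<bar>t + s\<bar> < S}"
    using s by (intro eventually_nhds_in_open) auto
  then show "\<forall>\<^sub>F t in nhds 0. meridian w (t + s) \<in> M"
    by (rule eventually_mono) (auto intro: meridian_in_M[OF w])
qed simp

text \<open>The meridian has speed W, so Cauchy-Schwarz bounds h'^2 by |grad f|^2 W^2; this is where
  the spherical part of the gradient is dropped.\<close>

lemma meridian_derivative:
  assumes f: "smooth_function_on M f" and w: "norm w = 1" and s: "\<bar>s\<bar> < S"
  defines "v \<equiv> surface_gradient M f (meridian w s)"
  shows "((\<lambda>s. f (meridian w s)) has_real_derivative v \<bullet> T (\<phi>' s *\<^sub>R w, 1)) (at s)"
    and "(v \<bullet> T (\<phi>' s *\<^sub>R w, 1))\<^sup>2 \<le> (norm v)\<^sup>2 * (W s)\<^sup>2"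
proof -
  have q: "meridian w s \<in> M" by (rule meridian_in_M[OF w s])
  have sub: "subspace (tangent_space M (meridian w s))"
    unfolding N_unit_normal(2)[OF q] by (rule subspace_hyperplane)
  from surface_gradient_works[OF sub f q curve_in_meridian[OF w s]]
  show "((\<lambda>s. f (meridian w s)) has_real_derivative v \<bullet> T (\<phi>' s *\<^sub>R w, 1)) (at s)"
    using DERIV_shift[of "\<lambda>s. f (meridian w s)" _ 0 s] by (simp add: v_def)
  have "T (\<phi>' s *\<^sub>R w, 1) \<bullet> T (\<phi>' s *\<^sub>R w, 1) = (W s)\<^sup>2"
    unfolding T_inner W_sq using w by (simp add: norm_eq_1 power2_eq_square)
  then show "(v \<bullet> T (\<phi>' s *\<^sub>R w, 1))\<^sup>2 \<le> (norm v)\<^sup>2 * (W s)\<^sup>2"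
    using Cauchy_Schwarz_ineq[of v "T (\<phi>' s *\<^sub>R w, 1)"] by (simp add: power2_norm_eq_inner)
qed

text \<open>Compactness keeps the support away from the ends: |s| attains a maximum on it, and this
  is below S. The midpoint between the maximum and S exceeds the maximum, so f vanishes already at
  |s| = b.\<close>

lemma test_function_support:
  assumes f: "test_function_on M f" and S: "0 < S"
  obtains b where "0 \<le> b" "b < S" "\<forall>q\<in>M. b \<le> \<bar>snd (pull q)\<bar> \<longrightarrow> f q = 0"
proof -
  define K where "K = M \<inter> closure {p \<in> M. f p \<noteq> 0}"
  have K: "compact K" using f by (simp add: test_function_on_def K_def)
  have zero: "f q = 0" if "q \<in> M" "q \<notin> K" for q
    using that closure_subset[of "{p \<in> M. f p \<noteq> 0}"] by (auto simp: K_def)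
  have "continuous_on K (\<lambda>q. \<bar>snd (pull q)\<bar>)" by (intro continuous_intros continuous_on_pull)
  show ?thesis
  proof (cases "K = {}")
    case True
    then show ?thesis using that[of 0] zero S by auto
  next
    case False
    obtain p where p: "p \<in> K" "\<And>q. q \<in> K \<Longrightarrow> \<bar>snd (pull q)\<bar> \<le> \<bar>snd (pull p)\<bar>"
      using continuous_attains_sup[OF K False \<open>continuous_on K _\<close>] by blast
    have "\<bar>snd (pull p)\<bar> < S" using p(1) M_subset_VN by (auto simp: K_def VN_def)
    then show ?thesis
      by (intro that[of "(\<bar>snd (pull p)\<bar> + S) / 2"]) (use p(2) zero in fastforce)+
  qed
qed

theorem stability_inequality:
  assumes f: "test_function_on M f"
  shows "0 \<le> (\<integral>p. (norm (surface_gradient M f p))\<^sup>2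
      - (1 - 2 / n) * norm_sq_second_fundamental_form M p * (f p)\<^sup>2 \<partial>surface_measure M)"
proof -
  define F where "F = (\<lambda>p. (norm (surface_gradient M f p))\<^sup>2
      - (1 - 2 / n) * norm_sq_second_fundamental_form M p * (f p)\<^sup>2)"
  define G where "G = (\<lambda>x. indicator U x * (volume_density (X 1) x * F (X 1 x)))"
  have smooth: "smooth_function_on M f" using f by (simp add: test_function_on_def)
  have n0: "0 < n" using n3 by (simp add: n_eq)
  have line: "0 \<le> (\<integral>t. G (x + t *\<^sub>R e\<^sub>k) \<partial>lborel)" if x: "x $ k = 0" for x
  proof (cases "0 < S")
    case False
    then have "U = {}" by (auto simp: U_def)
    then show ?thesis by (simp add: G_def)
  next
    case S: True
    obtain b where b: "0 \<le> b" "b < S" "\<forall>q\<in>M. b \<le> \<bar>snd (pull q)\<bar> \<longrightarrow> f q = 0"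
      using test_function_support[OF f S] .
    obtain C where C: "0 \<le> C" "\<forall>s. \<bar>s\<bar> < S \<longrightarrow> \<phi> s ^ (CARD('n) - 1) / W s = C"
      using first_integral .
    define w where "w = stereo k 1 x"
    have w: "norm w = 1" unfolding w_def by (rule norm_stereo) simp
    define h where "h = (\<lambda>s. f (meridian w s))"
    define h' where "h' = (\<lambda>s. surface_gradient M f (meridian w s) \<bullet> T (\<phi>' s *\<^sub>R w, 1))"
    have Xm: "X 1 (x + t *\<^sub>R e\<^sub>k) = meridian w t" for t
      by (simp add: X_def meridian_def w_def x)
    have h0: "h s = 0" if "\<bar>s\<bar> < S" "b \<le> \<bar>s\<bar>" for s
      unfolding h_def using that
      by (intro b(3)[rule_format] meridian_in_M[OF w]) (simp_all add: meridian_def)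
    \<comment> \<open>The first integral turns the volume factor W phi^(n-1) into C W^2. This W^2
      cancels the one in the denominator of |A|^2 and is the factor that
      \<open>meridian_derivative\<close> asks for beside |grad f|^2.\<close>
    have G_in: "G (x + t *\<^sub>R e\<^sub>k) = C * angular_density x * ((norm (surface_gradient M f (meridian w t)))\<^sup>2 * (W t)\<^sup>2
        - (n - 1) * (n - 2) * (h t)\<^sup>2 / (\<phi> t)\<^sup>2)" if t: "\<bar>t\<bar> < S" for t
    proof -
      have xU: "x + t *\<^sub>R e\<^sub>k \<in> U" using t x by (simp add: U_def)
      have A: "norm_sq_second_fundamental_form M (meridian w t) = n * (n - 1) / (\<phi> t * W t)\<^sup>2"
        using norm_sq_A[OF _ xU, of 1] by (simp add: Xm x)
      have vol: "volume_density (X 1) (x + t *\<^sub>R e\<^sub>k) = C * (W t)\<^sup>2 * angular_density x"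
        using volume_density_X[OF xU] C(2)[rule_format, OF t] W_pos[of t]
        by (simp add: x angular_density_shift field_simps power2_eq_square)
      have "G (x + t *\<^sub>R e\<^sub>k) = C * (W t)\<^sup>2 * angular_density x * ((norm (surface_gradient M f (meridian w t)))\<^sup>2
        - (1 - 2 / n) * (n * (n - 1) / (\<phi> t * W t)\<^sup>2) * (h t)\<^sup>2)"
        using xU by (simp add: G_def vol Xm F_def A h_def)
      also have "(1 - 2 / n) * (n * (n - 1) / (\<phi> t * W t)\<^sup>2) * (h t)\<^sup>2 =
          (n - 1) * (n - 2) * (h t)\<^sup>2 / (\<phi> t)\<^sup>2 / (W t)\<^sup>2"
      proof -
        have e: "(1 - 2 / n) * (n * (n - 1)) = (n - 1) * (n - 2)"
          using n0 by (simp add: field_simps)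
        have "(1 - 2 / n) * (n * (n - 1) / (\<phi> t * W t)\<^sup>2) * (h t)\<^sup>2 =
            (1 - 2 / n) * (n * (n - 1)) * (h t)\<^sup>2 / (\<phi> t)\<^sup>2 / (W t)\<^sup>2"
          by (simp only: power_mult_distrib divide_divide_eq_left times_divide_eq_left times_divide_eq_right)
        then show ?thesis unfolding e .
      qed
      also have "C * (W t)\<^sup>2 * angular_density x * ((norm (surface_gradient M f (meridian w t)))\<^sup>2 -
          (n - 1) * (n - 2) * (h t)\<^sup>2 / (\<phi> t)\<^sup>2 / (W t)\<^sup>2) =
        C * angular_density x * ((norm (surface_gradient M f (meridian w t)))\<^sup>2 * (W t)\<^sup>2
        - (n - 1) * (n - 2) * (h t)\<^sup>2 / (\<phi> t)\<^sup>2)"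
      proof -
        have "y * y' * z * (u - v / y') = y * z * (u * y' - v)" if "y' \<noteq> 0" for y y' z u v :: real
          using that by (simp add: field_simps)
        note this[of "(W t)\<^sup>2" C "angular_density x"]
        then show ?thesis using W_pos[of t] by (metis less_irrefl power_not_zero)
      qed
      finally show ?thesis .
    qed
    have Cc: "0 \<le> C * angular_density x" using C(1) angular_density_nonneg by simp
    show ?thesis
    proof (rule catenoid_hardy_inequality[where a="-b" and b=b and C="C * angular_density x" and n=n
          and \<phi>=\<phi> and \<phi>'=\<phi>' and h=h and h'=h'])
      \<comment> \<open>Outside [-b, b] either h vanishes and only the gradient term is left, or |s|
        >= S and the indicator of \<open>U\<close> is 0.\<close>
      fix s assume "s \<notin> {-b..b}"
      then have s: "b \<le> \<bar>s\<bar>" by auto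
      show "0 \<le> G (x + s *\<^sub>R e\<^sub>k)"
      proof (cases "\<bar>s\<bar> < S")
        case True
        then show ?thesis using Cc by (simp add: G_in h0[OF True s])
      next
        case False
        then show ?thesis using x by (simp add: G_def U_def)
      qed
    next
      fix s assume "s \<in> {-b..b}"
      then have s: "\<bar>s\<bar> < S" using b(2) by auto
      show "0 < \<phi> s" "(\<phi> has_real_derivative \<phi>' s) (at s)"
        "(\<phi>' has_real_derivative (n - 1) * (1 + (\<phi>' s)\<^sup>2) / \<phi> s) (at s)"
        using pos d\<phi> d\<phi>' s by auto
      show "(h has_real_derivative h' s) (at s)"
        unfolding h_def h'_def by (rule meridian_derivative(1)[OF smooth w s])
      show "C * angular_density x * ((h' s)\<^sup>2 - (n - 1) * (n - 2) * (h s)\<^sup>2 / (\<phi> s)\<^sup>2) \<le> G (x + s *\<^sub>R e\<^sub>k)"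
        unfolding G_in[OF s]
        using meridian_derivative(2)[OF smooth w s] Cc
        by (intro mult_left_mono) (simp_all add: h'_def)
    qed (use b Cc h0 in auto)
  qed
  have "0 \<le> (\<integral>p. F p \<partial>chart_measure M U (X 1))"
  \<comment> \<open>In the first case measurability of \<open>F\<close> comes with integrability; in
    the second the integral is 0.\<close>
  proof (cases "integrable (chart_measure M U (X 1)) F")
    case True
    have ch: "adapted_chart M U (X 1) (Y 1) (V 1)" by (rule adapted_chart_X) simp
    note I = integral_chart_measure[OF ch True, folded G_def]
    have "0 \<le> (\<integral>x. G x \<partial>lborel)"
      by (rule integral_nonneg_if_line_integrals_nonneg[OF I(1), of e\<^sub>k S])
        (use line in \<open>auto simp: inner_axis G_def U_def\<close>)
    then show ?thesis unfolding I(2) .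
  qed (simp add: not_integrable_integral_eq)
  then show ?thesis unfolding surface_measure_M F_def .
qed

end

section \<open>From the definition of a catenoid to the locale\<close>

lemma profile_equation_solved:
  fixes p q y n :: real
  assumes "0 < y" "q / (1 + p\<^sup>2) powr (3/2) - (n - 1) / (y * (1 + p\<^sup>2) powr (1/2)) = 0"
  shows "q = (n - 1) * (1 + p\<^sup>2) / y"
proof -
  have p: "0 < 1 + p\<^sup>2" by (simp add: add_pos_nonneg)
  define r where "r = (1 + p\<^sup>2) powr (1/2)"
  have r: "0 < r" using p by (simp add: r_def)
  have "(1 + p\<^sup>2) powr (3/2) = (1 + p\<^sup>2) powr (1 + 1/2)" by simp
  also have "\<dots> = (1 + p\<^sup>2) * r" using p unfolding r_def powr_add by simp
  finally have "q / ((1 + p\<^sup>2) * r) = (n - 1) / (y * r)"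
    using assms(2) by (simp add: r_def)
  then have "q * (y * r) = (n - 1) * ((1 + p\<^sup>2) * r)"
    using r p assms(1) by (subst (asm) frac_eq_eq) auto
  then have "q * y = (n - 1) * (1 + p\<^sup>2)" using r by simp
  then show ?thesis using assms(1) by (simp add: eq_divide_eq)
qed

theorem mainTheorem4:
  fixes M :: "((real ^ 'n) \<times> real) set"
  assumes "CARD('n) \<ge> 3"
    and "is_catenoid M"
  shows "delta_stable (2 / real CARD('n)) M"
proof -
  obtain \<phi>\<^sub>0 \<phi> g where prof: "catenoid_profile CARD('n) \<phi>\<^sub>0 \<phi>" and g: "rigid_motion g"
    and M: "M = g ` ((\<lambda>(s, \<omega>). (\<phi> s *\<^sub>R \<omega>, s)) ` (catenoid_interval CARD('n) \<phi>\<^sub>0 \<times> sphere 0 1))"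
    using assms(2) unfolding is_catenoid_def by blast
  obtain T a where T: "orthogonal_transformation T" and g_eq: "g = (\<lambda>x. T x + a)"
    using g unfolding rigid_motion_def by blast
  define S where "S = catenoid_halfwidth CARD('n) \<phi>\<^sub>0"
  have I: "catenoid_interval CARD('n) \<phi>\<^sub>0 = {s. \<bar>s\<bar> < S}"
    by (auto simp: catenoid_interval_def S_def abs_less_iff)
  have cat: "catenoid S \<phi> (deriv \<phi>) T (real CARD('n))"
  proof
    fix s :: real assume "\<bar>s\<bar> < S"
    then have s: "0 < \<phi> s" "\<phi> differentiable (at s)" "deriv \<phi> differentiable (at s)"
      "deriv (deriv \<phi>) s / (1 + (deriv \<phi> s)\<^sup>2) powr (3/2)
          - (real CARD('n) - 1) / (\<phi> s * (1 + (deriv \<phi> s)\<^sup>2) powr (1/2)) = 0"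
      using prof unfolding catenoid_profile_def I by auto
    show "0 < \<phi> s" by (rule s(1))
    show "(\<phi> has_real_derivative deriv \<phi> s) (at s)"
      using s(2) by (metis DERIV_imp_deriv real_differentiable_def)
    have "(deriv \<phi> has_real_derivative deriv (deriv \<phi>) s) (at s)"
      using s(3) by (metis DERIV_imp_deriv real_differentiable_def)
    then show "(deriv \<phi> has_real_derivative (real CARD('n) - 1) * (1 + (deriv \<phi> s)\<^sup>2) / \<phi> s) (at s)"
      unfolding profile_equation_solved[OF s(1,4)] .
  qed (use T assms(1) in auto)
  have M_eq: "M = catenoid.M S \<phi> T a"
    unfolding catenoid.M_def[OF cat] M I g_eq image_image by (simp add: case_prod_unfold)
  show ?thesis
    unfolding delta_stable_def M_eq
    by (intro allI impI catenoid.stability_inequality[OF cat])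
qed

end
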